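(* Let $G,H:I\to\mathbb{R}$ be continuous functions such that for all $x\in I$: $G(x)\le H(x)$, $E_x[\sup_{t\ge0}|e^{-rt}G(X_t)|]<\infty$, $E_x[\sup_{t\ge0}|e^{-rt}H(X_t)|]<\infty$ and $P_x(\lim_{t\to\infty}e^{-rt}G(X_t)=\lim_{t\to\infty}e^{-rt}H(X_t))=1$. Then the functions $(G)_H^{**}$ and $(H)^G_{**}$ on $I$ satisfy $$(G)_H^{**}\in\mathrm{Sup}[G,H)\cap\mathrm{Sub}(G,H]\qquad\text{and}\qquad (H)^G_{**}\in\mathrm{Sup}[G,H)\cap\mathrm{Sub}(G,H].$$
   Context: Setting. $I=(a,b)\subseteq\mathbb{R}$ is an open interval and $X$ is a regular one-dimensional diffusion with state space $I$, $X_0=x$ under $P_x$, with natural boundaries ($P_x(T_a<\infty)=P_x(T_b<\infty)=0$, $T_y=\inf\{t\ge0:X_t=y\}$), generator $\mathbb{L}_X$, and $r>0$ is fixed. $\varphi$ (increasing) and $\psi$ (decreasing) are the positive, continuous, strictly monotone solutions on $I$ of $\mathbb{L}_Xf=rf$ with $\varphi(a+)=\psi(b-)=0$, $\varphi(b-)=\psi(a+)=+\infty$; $E_x[e^{-rT_y}\mathbb{I}_{[T_y<\infty]}]=\psi(x)/\psi(y)$ for $x>y$ and $=\varphi(x)/\varphi(y)$ for $x\le y$. $F=\varphi/\psi:I\to(0,\infty)$ is a strictly increasing continuous bijection. Admissible sets. $\mathrm{Sup}[G,H)=\{U:I\to\mathbb{R}\mid G\le U\le H,\ U$ continuous and $r$-superharmonic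 on $\{U<H\}\}$, $\mathrm{Sub}(G,H]=\{U:I\to\mathbb{R}\mid G\le U\le H,\ U$ continuous and $r$-subharmonic on $\{U>G\}\}$. Here $U$ is $r$-superharmonic on an open set $A\subseteq I$ if $U/\psi$ is $F$-concave on every interval contained in $A$, i.e. $\frac{U}{\psi}(x)\ge\frac{U}{\psi}(y)\frac{F(z)-F(x)}{F(z)-F(y)}+\frac{U}{\psi}(z)\frac{F(x)-F(y)}{F(z)-F(y)}$ whenever $y\le x\le z$, $y<z$, $[y,z]\subseteq A$ (equivalently $U(x)\ge E_x[e^{-r(T_y\wedge T_z)}U(X_{T_y\wedge T_z})]$ for such $y,x,z$); $r$-subharmonic on $A$ is the same with the inequality reversed. Transformed functions. $W^G=(G/\psi)\circ F^{-1}$, $W_H=(H/\psi)\circ F^{-1}$ on $(0,\infty)$. For $f:(0,\infty)\to\mathbb{R}$, $x>0$, $c,p\in\mathbb{R}$: $l_f^x(c,p)=\sup\{z\le x: f(z)-p=c(z-x)\}$, $r_f^x(c,p)=\inf\{y\ge x: f(y)-p=c(y-x)\}$, with $\sup\emptyset=0$, $\inf\emptyset=+\infty$; write $l_G^x,r_G^x$ for $f=W^G$ and $l_H^x,r_H^x$ for $f=W_H$. Put $\widehat{\mathcal A}_G^x(c)=\bigcup_{p\in[W^G(x),W_H(x)]}\{y>0: l_H^x(c,p)\le l_G^x(c,p)\le y\le r_G^x(c,p)\le r_H^x(c,p)\}$, $\widehat{\mathcal A}^H_x(c)=\bigcup_{p\in[W^G(x),W_H(x)]}\{y>0: l_G^x(c,p)\le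 l_H^x(c,p)\le y\le r_H^x(c,p)\le r_G^x(c,p)\}$, $(W^G)_H^{**}(x)=\sup_{z\in\mathbb{R}}\sup_{y\in\widehat{\mathcal A}_G^x(z)}(z(x-y)+W^G(y))$, $(W_H)^G_{**}(x)=\inf_{z\in\mathbb{R}}\inf_{y\in\widehat{\mathcal A}^H_x(z)}(z(x-y)+W_H(y))$ for $x>0$, and for $x\in I$, $(G)_H^{**}(x)=(W^G)_H^{**}(F(x))\psi(x)$, $(H)^G_{**}(x)=(W_H)^G_{**}(F(x))\psi(x)$. *)

theory Defs
  imports "HOL-Probability.Probability"
begin

section \<open>Regular one-dimensional diffusions with natural boundaries\<close>

text \<open>Levels are extended reals, so that the (possibly infinite) endpoints of the state space
  are admissible levels. The infimum of the empty set is \<open>\<infinity>\<close>.\<close>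

definition hitting_time :: "(real \<Rightarrow> 'w \<Rightarrow> real) \<Rightarrow> ereal \<Rightarrow> 'w \<Rightarrow> ennreal" where
  "hitting_time X y \<omega> = (INF t\<in>{t. 0 \<le> t \<and> ereal (X t \<omega>) = y}. ennreal t)"

text \<open>The time index of the filtration is \<open>[0,\<infinity>]\<close>; \<open>\<F> \<infinity>\<close> is the ambient \<open>\<sigma>\<close>-algebra, on which
  all the laws \<open>P x\<close> live. The strong Markov property is required for one time \<open>t\<close> after an
  arbitrary stopping time \<open>\<tau>\<close>; replacing \<open>\<tau>\<close> by \<open>\<tau> + t\<close> gives the finite-dimensional laws of the
  process after \<open>\<tau>\<close>. Only transition probabilities are required to be Borel in the starting point,
  so that augmented filtrations are covered.\<close>

locale regular_diffusion = filtration \<Omega> \<F>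
  for \<Omega> :: "'w set" and \<F> :: "ennreal \<Rightarrow> 'w measure" +
  fixes a b :: ereal and P :: "real \<Rightarrow> 'w measure" and X :: "real \<Rightarrow> 'w \<Rightarrow> real"
  assumes endpoints: "a < b"
    and prob_P: "\<And>x. x \<in> einterval a b \<Longrightarrow> prob_space (P x)"
    and sets_P: "\<And>x. x \<in> einterval a b \<Longrightarrow> sets (P x) = sets (\<F> \<infinity>)"
    and adapted: "\<And>t. 0 \<le> t \<Longrightarrow> X t \<in> borel_measurable (\<F> (ennreal t))"
    and state_space: "\<And>t \<omega>. 0 \<le> t \<Longrightarrow> \<omega> \<in> \<Omega> \<Longrightarrow> X t \<omega> \<in> einterval a b"
    and continuous_paths: "\<And>\<omega>. \<omega> \<in> \<Omega> \<Longrightarrow> continuous_on {0..} (\<lambda>t. X t \<omega>)"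
    and start: "\<And>x. x \<in> einterval a b \<Longrightarrow> AE \<omega> in P x. X 0 \<omega> = x"
    and measurable_transition: "\<And>t B. 0 \<le> t \<Longrightarrow> B \<in> sets borel \<Longrightarrow>
      (\<lambda>y. measure (P y) {\<omega>\<in>\<Omega>. X t \<omega> \<in> B}) \<in> borel_measurable (restrict_space borel (einterval a b))"
    and strong_markov: "\<And>x \<tau> A t B. x \<in> einterval a b \<Longrightarrow> stopping_time \<F> \<tau> \<Longrightarrow>
      A \<in> sets (pre_sigma \<tau>) \<Longrightarrow> 0 \<le> t \<Longrightarrow> B \<in> sets borel \<Longrightarrow>
      measure (P x) {\<omega>\<in>A. \<tau> \<omega> < \<infinity> \<and> X (enn2real (\<tau> \<omega>) + t) \<omega> \<in> B} =
      (\<integral>\<omega>. indicator {\<omega>\<in>A. \<tau> \<omega> < \<infinity>} \<omega> *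
            measure (P (X (enn2real (\<tau> \<omega>)) \<omega>)) {\<omega>'\<in>\<Omega>. X t \<omega>' \<in> B} \<partial>P x)"
    and regular: "\<And>x y. x \<in> einterval a b \<Longrightarrow> y \<in> einterval a b \<Longrightarrow>
      measure (P x) {\<omega>\<in>\<Omega>. hitting_time X (ereal y) \<omega> < \<infinity>} > 0"
    and natural_left: "\<And>x. x \<in> einterval a b \<Longrightarrow> AE \<omega> in P x. \<not> hitting_time X a \<omega> < \<infinity>"
    and natural_right: "\<And>x. x \<in> einterval a b \<Longrightarrow> AE \<omega> in P x. \<not> hitting_time X b \<omega> < \<infinity>"
begin

text \<open>The generator, in Dynkin's sense of the characteristic operator: this form also applies to
  unbounded functions. The time \<open>exit_time y z\<close> is integrable under \<open>P x\<close> for \<open>y < x < z\<close>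
  by regularity.\<close>

definition exit_time :: "real \<Rightarrow> real \<Rightarrow> 'w \<Rightarrow> ennreal" where
  "exit_time y z \<omega> = min (hitting_time X (ereal y) \<omega>) (hitting_time X (ereal z) \<omega>)"

definition has_generator_at :: "(real \<Rightarrow> real) \<Rightarrow> real \<Rightarrow> real \<Rightarrow> bool" where
  "has_generator_at f v x \<longleftrightarrow>
    ((\<lambda>(y, z). ((\<integral>\<omega>. f (X (enn2real (exit_time y z \<omega>)) \<omega>) \<partial>P x) - f x) /
               (\<integral>\<omega>. enn2real (exit_time y z \<omega>) \<partial>P x))
      \<longlongrightarrow> v) (at_left x \<times>\<^sub>F at_right x)"

end

text \<open>The limits at the endpoints are taken along \<open>at_right a\<close> and \<open>at_left b\<close> in the extended
  reals, as for interval integrals.\<close>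

locale discounted_diffusion = regular_diffusion \<Omega> \<F> a b P X
  for \<Omega> :: "'w set" and \<F> :: "ennreal \<Rightarrow> 'w measure" and a b :: ereal
    and P :: "real \<Rightarrow> 'w measure" and X :: "real \<Rightarrow> 'w \<Rightarrow> real" +
  fixes r :: real and \<phi> \<psi> :: "real \<Rightarrow> real"
  assumes r_pos: "r > 0"
    and \<phi>_pos: "\<And>x. x \<in> einterval a b \<Longrightarrow> \<phi> x > 0"
    and \<psi>_pos: "\<And>x. x \<in> einterval a b \<Longrightarrow> \<psi> x > 0"
    and \<phi>_continuous: "continuous_on (einterval a b) \<phi>"
    and \<psi>_continuous: "continuous_on (einterval a b) \<psi>"
    and \<phi>_increasing: "strict_mono_on (einterval a b) \<phi>"
    and \<psi>_decreasing: "strict_antimono_on (einterval a b) \<psi>"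
    and \<phi>_generator: "\<And>x. x \<in> einterval a b \<Longrightarrow> has_generator_at \<phi> (r * \<phi> x) x"
    and \<psi>_generator: "\<And>x. x \<in> einterval a b \<Longrightarrow> has_generator_at \<psi> (r * \<psi> x) x"
    and \<phi>_left: "((\<phi> \<circ> real_of_ereal) \<longlongrightarrow> 0) (at_right a)"
    and \<phi>_right: "filterlim (\<phi> \<circ> real_of_ereal) at_top (at_left b)"
    and \<psi>_left: "filterlim (\<psi> \<circ> real_of_ereal) at_top (at_right a)"
    and \<psi>_right: "((\<psi> \<circ> real_of_ereal) \<longlongrightarrow> 0) (at_left b)"
    and laplace_hitting: "\<And>x y. x \<in> einterval a b \<Longrightarrow> y \<in> einterval a b \<Longrightarrow>
      (\<integral>\<omega>. (if hitting_time X (ereal y) \<omega> < \<infinity>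
             then exp (- r * enn2real (hitting_time X (ereal y) \<omega>)) else 0) \<partial>P x) =
      (if x > y then \<psi> x / \<psi> y else \<phi> x / \<phi> y)"

section \<open>Superharmonic and subharmonic functions, admissible sets\<close>

definition scale_quotient :: "(real \<Rightarrow> real) \<Rightarrow> (real \<Rightarrow> real) \<Rightarrow> real \<Rightarrow> real" where
  "scale_quotient \<phi> \<psi> x = \<phi> x / \<psi> x"

text \<open>The discount rate enters the next definitions only through \<open>\<phi>\<close> and \<open>\<psi>\<close>.\<close>

definition superharmonic_on ::
  "(real \<Rightarrow> real) \<Rightarrow> (real \<Rightarrow> real) \<Rightarrow> real set \<Rightarrow> (real \<Rightarrow> real) \<Rightarrow> bool" where
  "superharmonic_on \<phi> \<psi> A U \<longleftrightarrow>
    (let F = scale_quotient \<phi> \<psi> in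
     \<forall>x y z. y \<le> x \<and> x \<le> z \<and> y < z \<and> {y..z} \<subseteq> A \<longrightarrow>
       U x / \<psi> x \<ge> U y / \<psi> y * ((F z - F x) / (F z - F y)) + U z / \<psi> z * ((F x - F y) / (F z - F y)))"

definition subharmonic_on ::
  "(real \<Rightarrow> real) \<Rightarrow> (real \<Rightarrow> real) \<Rightarrow> real set \<Rightarrow> (real \<Rightarrow> real) \<Rightarrow> bool" where
  "subharmonic_on \<phi> \<psi> A U \<longleftrightarrow>
    (let F = scale_quotient \<phi> \<psi> in
     \<forall>x y z. y \<le> x \<and> x \<le> z \<and> y < z \<and> {y..z} \<subseteq> A \<longrightarrow>
       U x / \<psi> x \<le> U y / \<psi> y * ((F z - F x) / (F z - F y)) + U z / \<psi> z * ((F x - F y) / (F z - F y)))"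

definition Sup_admissible :: "real set \<Rightarrow> (real \<Rightarrow> real) \<Rightarrow> (real \<Rightarrow> real) \<Rightarrow>
    (real \<Rightarrow> real) \<Rightarrow> (real \<Rightarrow> real) \<Rightarrow> (real \<Rightarrow> real) set" where
  "Sup_admissible I \<phi> \<psi> G H = {U. (\<forall>x\<in>I. G x \<le> U x \<and> U x \<le> H x) \<and> continuous_on I U \<and>
     superharmonic_on \<phi> \<psi> {x\<in>I. U x < H x} U}"

definition Sub_admissible :: "real set \<Rightarrow> (real \<Rightarrow> real) \<Rightarrow> (real \<Rightarrow> real) \<Rightarrow>
    (real \<Rightarrow> real) \<Rightarrow> (real \<Rightarrow> real) \<Rightarrow> (real \<Rightarrow> real) set" where
  "Sub_admissible I \<phi> \<psi> G H = {U. (\<forall>x\<in>I. G x \<le> U x \<and> U x \<le> H x) \<and> continuous_on I U \<and>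
     subharmonic_on \<phi> \<psi> {x\<in>I. U x > G x} U}"

section \<open>Constrained biconjugates\<close>

definition transformed :: "real set \<Rightarrow> (real \<Rightarrow> real) \<Rightarrow> (real \<Rightarrow> real) \<Rightarrow>
    (real \<Rightarrow> real) \<Rightarrow> real \<Rightarrow> real" where
  "transformed I \<phi> \<psi> f w =
    (let x = inv_into I (scale_quotient \<phi> \<psi>) w in f x / \<psi> x)"

definition left_contact :: "(real \<Rightarrow> real) \<Rightarrow> real \<Rightarrow> real \<Rightarrow> real \<Rightarrow> real" where
  "left_contact f x c p =
    (let Z = {z. 0 < z \<and> z \<le> x \<and> f z - p = c * (z - x)} in if Z = {} then 0 else Sup Z)"

definition right_contact :: "(real \<Rightarrow> real) \<Rightarrow> real \<Rightarrow> real \<Rightarrow> real \<Rightarrow> ereal" where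
  "right_contact f x c p = (INF y\<in>{y. x \<le> y \<and> f y - p = c * (y - x)}. ereal y)"

text \<open>\<open>V\<close> is the lower and \<open>W\<close> the upper obstacle.\<close>

definition lower_domain :: "(real \<Rightarrow> real) \<Rightarrow> (real \<Rightarrow> real) \<Rightarrow> real \<Rightarrow> real \<Rightarrow> real set" where
  "lower_domain V W x c = (\<Union>p\<in>{V x..W x}. {y. 0 < y \<and>
     left_contact W x c p \<le> left_contact V x c p \<and> left_contact V x c p \<le> y \<and>
     ereal y \<le> right_contact V x c p \<and> right_contact V x c p \<le> right_contact W x c p})"

definition upper_domain :: "(real \<Rightarrow> real) \<Rightarrow> (real \<Rightarrow> real) \<Rightarrow> real \<Rightarrow> real \<Rightarrow> real set" where
  "upper_domain V W x c = (\<Union>p\<in>{V x..W x}. {y. 0 < y \<and>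
     left_contact V x c p \<le> left_contact W x c p \<and> left_contact W x c p \<le> y \<and>
     ereal y \<le> right_contact W x c p \<and> right_contact W x c p \<le> right_contact V x c p})"

text \<open>Extended-real values: the inner domain may be empty for some slopes, in which case the
  inner supremum is \<open>-\<infinity>\<close> (the inner infimum is \<open>\<infinity>\<close>) and does not contribute.\<close>

definition lower_biconjugate :: "(real \<Rightarrow> real) \<Rightarrow> (real \<Rightarrow> real) \<Rightarrow> real \<Rightarrow> ereal" where
  "lower_biconjugate V W x = (SUP c. SUP y\<in>lower_domain V W x c. ereal (c * (x - y) + V y))"

definition upper_biconjugate :: "(real \<Rightarrow> real) \<Rightarrow> (real \<Rightarrow> real) \<Rightarrow> real \<Rightarrow> ereal" where
  "upper_biconjugate V W x = (INF c. INF y\<in>upper_domain V W x c. ereal (c * (x - y) + W y))"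

definition lower_value :: "real set \<Rightarrow> (real \<Rightarrow> real) \<Rightarrow> (real \<Rightarrow> real) \<Rightarrow>
    (real \<Rightarrow> real) \<Rightarrow> (real \<Rightarrow> real) \<Rightarrow> real \<Rightarrow> ereal" where
  "lower_value I \<phi> \<psi> G H x =
    lower_biconjugate (transformed I \<phi> \<psi> G) (transformed I \<phi> \<psi> H) (scale_quotient \<phi> \<psi> x) * ereal (\<psi> x)"

definition upper_value :: "real set \<Rightarrow> (real \<Rightarrow> real) \<Rightarrow> (real \<Rightarrow> real) \<Rightarrow>
    (real \<Rightarrow> real) \<Rightarrow> (real \<Rightarrow> real) \<Rightarrow> real \<Rightarrow> ereal" where
  "upper_value I \<phi> \<psi> G H x =
    upper_biconjugate (transformed I \<phi> \<psi> G) (transformed I \<phi> \<psi> H) (scale_quotient \<phi> \<psi> x) * ereal (\<psi> x)"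

end

theory Submission
  imports Defs
begin

text \<open>On the scale \<open>F\<close> both admissible sets describe the taut string between the obstacles
  \<open>V \<le> W\<close> on \<open>(0,\<infinity>)\<close>: a function that is convex off \<open>V\<close> and concave off \<open>W\<close>. It exists as the
  largest function between \<open>V\<close> and \<open>W\<close> that is convex off \<open>V\<close>, since raising it to a chord that stays
  below \<open>W\<close> does not leave this class. Up to an arbitrarily small error, the lower biconjugate
  at \<open>x\<close> is the supremum of the heights at \<open>x\<close> of lines that meet \<open>V\<close> before \<open>W\<close> on both sides. No such
  line lies above the taut string \<open>u\<close> at \<open>x\<close>, because \<open>u\<close> is concave as long as the line stays below
  \<open>W\<close>; here the gap \<open>W - V\<close> has to be negligible at both ends. Conversely a support line of \<open>u\<close> at
  \<open>x\<close>, lowered slightly, is such a line. The upper biconjugate follows by negation. The gap is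
  negligible at the ends by dominated convergence along the hitting times of levels tending to an
  endpoint, whose discounted expectations are quotients of \<open>\<phi>\<close> or \<open>\<psi>\<close>.\<close>

section \<open>Functions that are convex off an obstacle\<close>

text \<open>For a continuous \<open>f \<ge> V\<close> this is convexity on the intervals where \<open>f > V\<close>; the present form is
  stable under arbitrary suprema and needs no continuity.\<close>

definition line_dominated :: "real set \<Rightarrow> (real \<Rightarrow> real) \<Rightarrow> (real \<Rightarrow> real) \<Rightarrow> bool" where
  "line_dominated S V f \<longleftrightarrow> (\<forall>y z c d. y \<le> z \<longrightarrow> {y..z} \<subseteq> S \<longrightarrow>
     f y \<le> c * y + d \<longrightarrow> f z \<le> c * z + d \<longrightarrow> (\<forall>t\<in>{y..z}. V t \<le> c * t + d) \<longrightarrow>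
     (\<forall>t\<in>{y..z}. f t \<le> c * t + d))"

lemma line_dominatedI:
  assumes "\<And>y z c d t. y \<le> z \<Longrightarrow> {y..z} \<subseteq> S \<Longrightarrow> f y \<le> c * y + d \<Longrightarrow> f z \<le> c * z + d \<Longrightarrow>
    (\<And>t. y \<le> t \<Longrightarrow> t \<le> z \<Longrightarrow> V t \<le> c * t + d) \<Longrightarrow> y \<le> t \<Longrightarrow> t \<le> z \<Longrightarrow> f t \<le> c * t + d"
  shows "line_dominated S V f"
  unfolding line_dominated_def Ball_def atLeastAtMost_iff using assms by blast

lemma line_dominatedD:
  assumes "line_dominated S V f" "y \<le> z" "{y..z} \<subseteq> S" "f y \<le> c * y + d" "f z \<le> c * z + d"
    and "\<And>t. y \<le> t \<Longrightarrow> t \<le> z \<Longrightarrow> V t \<le> c * t + d" and "y \<le> t" "t \<le> z"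
  shows "f t \<le> c * t + d"
  using assms unfolding line_dominated_def Ball_def atLeastAtMost_iff by blast

text \<open>Free of orientation, so that one argument covers a point on either side of
  another.\<close>

lemma line_dominated_segmentD:
  assumes "line_dominated S V f" "closed_segment y z \<subseteq> S" "f y \<le> c * y + d" "f z \<le> c * z + d"
    and "\<And>t. t \<in> closed_segment y z \<Longrightarrow> V t \<le> c * t + d" and "t \<in> closed_segment y z"
  shows "f t \<le> c * t + d"
proof (cases "y \<le> z")
  case True
  then have "closed_segment y z = {y..z}" by (simp add: closed_segment_eq_real_ivl)
  then show ?thesis using line_dominatedD[OF assms(1), of y z c d t] assms True by auto
next
  case False
  then have "closed_segment y z = {z..y}" by (simp add: closed_segment_eq_real_ivl)
  then show ?thesis using line_dominatedD[OF assms(1), of z y c d t] assms False by auto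
qed

lemma line_dominated_refl: "line_dominated S V V"
  by (simp add: line_dominated_def)

section \<open>Existence and continuity of the taut string\<close>

lemma affine_le_affine:
  fixes a b c d k e t :: real
  assumes "c * a + d \<le> k * a + e" "c * b + d \<le> k * b + e" "a \<le> t" "t \<le> b"
  shows "c * t + d \<le> k * t + e"
proof (cases "c \<le> k")
  case True
  then have "(k - c) * a \<le> (k - c) * t" using assms by (intro mult_left_mono) auto
  then show ?thesis using assms by (simp add: algebra_simps)
next
  case False
  then have "(c - k) * t \<le> (c - k) * b" using assms by (intro mult_left_mono) auto
  then show ?thesis using assms by (simp add: algebra_simps)
qed

lemma frequently_le_limit:
  fixes h :: "real \<Rightarrow> real"
  assumes "isCont h x" "\<exists>\<^sub>F t in at x. q \<le> h t"
  shows "q \<le> h x"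
proof (rule ccontr)
  assume "\<not> q \<le> h x"
  then have "\<forall>\<^sub>F t in at x. h t < q"
    using assms(1) by (intro order_tendstoD) (auto simp: isCont_def)
  then show False using assms(2) by (simp add: frequently_def not_le)
qed

text \<open>If \<open>u\<close> were at most \<open>q < u x\<close> at points \<open>t\<close>
  arbitrarily near \<open>x\<close>, a line from slightly above \<open>q\<close> at such a
  \<open>t\<close> to a fixed point beyond \<open>x\<close> would dominate \<open>V\<close> on the
  segment and \<open>u\<close> at its ends, yet pass below \<open>u x\<close> at
  \<open>x\<close>.\<close>

lemma line_dominated_lower_semicontinuous:
  assumes "open S" "x \<in> S" "continuous_on S V" "\<And>t. t \<in> S \<Longrightarrow> V t \<le> u t"
    and dom: "line_dominated S V u" and "q < u x"
  shows "\<forall>\<^sub>F t in at x. q < u t"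
proof (rule ccontr)
  assume "\<not> ?thesis"
  then have freq: "\<exists>\<^sub>F t in at x. u t \<le> q" by (simp add: frequently_def not_le)
  have Vx: "isCont V x" using assms by (auto simp: continuous_on_eq_continuous_at)
  have evS: "\<forall>\<^sub>F t in at x. t \<in> S" using assms by (auto simp: eventually_at_in_open')
  have "\<exists>\<^sub>F t in at x. - q \<le> - V t"
    using frequently_eventually_conj[OF freq evS] by (rule frequently_elim1) (use assms(4) in force)
  then have "V x \<le> q" using frequently_le_limit[of x "\<lambda>t. - V t" "- q"] Vx by simp
  \<comment> \<open>A level strictly between \<open>q\<close> and \<open>u x\<close>: it leaves room
    for \<open>V\<close>, which stays below \<open>q'\<close> near \<open>x\<close> because
    \<open>V x \<le> q\<close>.\<close>
  define q' where "q' = (q + u x) / 2"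
  have q': "q < q'" "q' < u x" using assms by (auto simp: q'_def)
  have "\<forall>\<^sub>F t in nhds x. V t < q' \<and> t \<in> S"
    using Vx \<open>V x \<le> q\<close> q' assms
    by (intro eventually_conj order_tendstoD(2)[of V "V x"] eventually_nhds_in_open)
      (auto simp: isCont_def tendsto_at_iff_tendsto_nhds)
  then obtain d where d: "d > 0" "\<And>t. dist t x < d \<Longrightarrow> V t < q' \<and> t \<in> S"
    by (auto simp: eventually_nhds_metric)
  define M where "M = max q' (max (u (x - d/2)) (u (x + d/2)))"
  have M: "q' \<le> M" "u (x - d/2) \<le> M" "u (x + d/2) \<le> M" by (auto simp: M_def)
  \<comment> \<open>\<open>g t\<close> will bound the height at \<open>x\<close> of the line started
    at \<open>t\<close>. Since \<open>g\<close> is continuous with \<open>g x = q' < u x\<close>,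
    some bad \<open>t\<close> satisfies \<open>g t < u x\<close>.\<close>
  define g where "g s = q' + (M - q') * \<bar>s - x\<bar> / (d/2)" for s
  have "isCont g x" unfolding g_def using d by (intro continuous_intros) auto
  moreover have "g x < u x" using q' by (simp add: g_def)
  ultimately have "\<forall>\<^sub>F t in at x. g t < u x" by (intro order_tendstoD) (auto simp: isCont_def)
  moreover have "\<forall>\<^sub>F t in at x. dist t x < d/2 \<and> t \<noteq> x" using d
    by (auto simp: eventually_at intro!: exI[of _ "d/2"])
  ultimately have "\<forall>\<^sub>F t in at x. g t < u x \<and> dist t x < d/2 \<and> t \<noteq> x" by eventually_elim auto
  then obtain t where t: "u t \<le> q" "g t < u x" "dist t x < d/2" "t \<noteq> x"
    using frequently_eventually_conj[OF freq] by (blast dest: frequently_ex)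
  \<comment> \<open>The fixed end of the line lies across \<open>x\<close> from \<open>t\<close>, so
    \<open>x\<close> is between them and the distance from \<open>y\<close> to \<open>t\<close> is
    at least \<open>d/2\<close>.\<close>
  define y where "y = (if t > x then x - d/2 else x + d/2)"
  have uy: "u y \<le> M" and y: "y \<noteq> t" "x \<in> closed_segment y t" "\<bar>y - t\<bar> \<ge> d/2"
    and near: "\<And>s. s \<in> closed_segment y t \<Longrightarrow> dist s x < d"
    using M t d by (auto simp: y_def closed_segment_eq_real_ivl dist_real_def split: if_splits)
  \<comment> \<open>Slope of the line through \<open>(t, q')\<close> and \<open>(y, M)\<close>. Both
    end values are at least \<open>q'\<close>, so the whole line runs above \<open>q'\<close> and
    hence above \<open>V\<close>.\<close>
  define m where "m = (M - q') / (y - t)"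
  have my: "m * y + (q' - m * t) = M"
  proof -
    have "m * (y - t) = M - q'" using y by (simp add: m_def)
    then show ?thesis by (simp add: algebra_simps)
  qed
  have ge: "q' \<le> m * s + (q' - m * t)" if "s \<in> closed_segment y t" for s
  proof (cases "y \<le> t")
    case True
    then show ?thesis using affine_le_affine[of 0 y q' m "q' - m * t" t s] my M that
      by (auto simp: closed_segment_eq_real_ivl)
  next
    case False
    then show ?thesis using affine_le_affine[of 0 t q' m "q' - m * t" y s] my M that
      by (auto simp: closed_segment_eq_real_ivl)
  qed
  have "u x \<le> m * x + (q' - m * t)"
  proof (rule line_dominated_segmentD[OF dom _ _ _ _ y(2)])
    show "closed_segment y t \<subseteq> S" using near d by blast
    show "u y \<le> m * y + (q' - m * t)" using my uy by simp
    show "u t \<le> m * t + (q' - m * t)" using t q' by simp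
    show "V s \<le> m * s + (q' - m * t)" if "s \<in> closed_segment y t" for s
      using ge[OF that] d(2)[OF near[OF that]] by simp
  qed
  also have "\<dots> = q' + m * (x - t)" by (simp add: algebra_simps)
  also have "m * (x - t) = (M - q') * \<bar>t - x\<bar> / \<bar>y - t\<bar>"
  proof (cases "x < t")
    case True
    then have "\<bar>t - x\<bar> = - (x - t)" "\<bar>y - t\<bar> = - (y - t)" using d by (auto simp: y_def)
    then show ?thesis by (simp only: m_def mult_minus_right minus_divide_divide) simp
  next
    case False
    then have "\<bar>t - x\<bar> = x - t" "\<bar>y - t\<bar> = y - t" using d by (auto simp: y_def)
    then show ?thesis by (simp add: m_def)
  qed
  also have "\<dots> \<le> (M - q') * \<bar>t - x\<bar> / (d/2)"
    using y d M by (intro divide_left_mono mult_nonneg_nonneg mult_pos_pos) auto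
  finally show False using t by (simp add: g_def)
qed

text \<open>Domination against \<open>W\<close> and upper semicontinuity both come from maximality
  of the supremum \<open>u\<close> of \<open>C\<close>: a modification of \<open>u\<close> that
  still belongs to \<open>C\<close> cannot exceed \<open>u\<close>. Lower semicontinuity needs only
  domination against \<open>V\<close>.\<close>

lemma taut_string_exists:
  assumes S: "open S" and V: "continuous_on S V" and W: "continuous_on S W"
    and VW: "\<And>x. x \<in> S \<Longrightarrow> V x \<le> W x"
  obtains u where "\<And>x. x \<in> S \<Longrightarrow> V x \<le> u x" "\<And>x. x \<in> S \<Longrightarrow> u x \<le> W x" "continuous_on S u"
    "line_dominated S V u" "line_dominated S (\<lambda>x. - W x) (\<lambda>x. - u x)"
proof -
  define C where "C = {f. (\<forall>x\<in>S. V x \<le> f x \<and> f x \<le> W x) \<and> line_dominated S V f}"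
  define u where "u x = (SUP f\<in>C. f x)" for x
  have VC: "V \<in> C" using VW by (simp add: C_def line_dominated_refl)
  have upper: "f x \<le> u x" if "f \<in> C" "x \<in> S" for f x
    unfolding u_def using that
    by (intro cSUP_upper bdd_aboveI[where M="W x"]) (auto simp: C_def)
  have least: "u x \<le> m" if "\<And>f. f \<in> C \<Longrightarrow> f x \<le> m" for x m
    unfolding u_def using VC that by (intro cSUP_least) auto
  have Vu: "V x \<le> u x" if "x \<in> S" for x by (rule upper[OF VC that])
  have uW: "u x \<le> W x" if "x \<in> S" for x by (rule least) (use that in \<open>simp add: C_def\<close>)
  have dom: "line_dominated S V u"
  proof (rule line_dominatedI)
    fix y z c d t assume *: "y \<le> z" "{y..z} \<subseteq> S" "u y \<le> c * y + d" "u z \<le> c * z + d"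
      "\<And>t. y \<le> t \<Longrightarrow> t \<le> z \<Longrightarrow> V t \<le> c * t + d" "y \<le> t" "t \<le> z"
    show "u t \<le> c * t + d"
    proof (rule least)
      fix f assume f: "f \<in> C"
      have "f y \<le> u y" "f z \<le> u z" using * by (auto intro!: upper[OF f])
      then have ends: "f y \<le> c * y + d" "f z \<le> c * z + d" using * by linarith+
      have "line_dominated S V f" using f by (simp add: C_def)
      then show "f t \<le> c * t + d" by (rule line_dominatedD[OF _ *(1,2) ends *(5-7)])
    qed
  qed
  have glue: "line_dominated S (\<lambda>x. - W x) (\<lambda>x. - u x)"
  proof (rule line_dominatedI)
    fix y z c d t assume *: "y \<le> z" "{y..z} \<subseteq> S" "- u y \<le> c * y + d" "- u z \<le> c * z + d"
      "\<And>t. y \<le> t \<Longrightarrow> t \<le> z \<Longrightarrow> - W t \<le> c * t + d" "y \<le> t" "t \<le> z"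
    define L where "L s = (- c) * s + (- d)" for s
    \<comment> \<open>\<open>u\<close> raised to the line \<open>L\<close> on \<open>{y..z}\<close>.
      As \<open>L\<close> is below \<open>W\<close> there, membership of \<open>g\<close> in
      \<open>C\<close> forces \<open>L\<close> below \<open>u\<close>.\<close>
    define g where "g s = (if s \<in> {y..z} then max (u s) (L s) else u s)" for s
    have "line_dominated S V g"
    proof (rule line_dominatedI)
      fix y' z' c' d' t'
      assume **: "y' \<le> z'" "{y'..z'} \<subseteq> S" "g y' \<le> c' * y' + d'" "g z' \<le> c' * z' + d'"
        "\<And>t. y' \<le> t \<Longrightarrow> t \<le> z' \<Longrightarrow> V t \<le> c' * t + d'" "y' \<le> t'" "t' \<le> z'"
      have gu: "u s \<le> g s" for s by (simp add: g_def)
      have u_le: "u s \<le> c' * s + d'" if "y' \<le> s" "s \<le> z'" for s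
        using ** gu[of y'] gu[of z'] that
        by - (rule line_dominatedD[OF dom **(1,2) _ _ **(5)], linarith+)
      \<comment> \<open>On the overlap of the two intervals it suffices to compare \<open>L\<close>
        with the test line at the ends. An end of the test interval is covered by the assumption on
        \<open>g\<close>; an end of \<open>{y..z}\<close> is covered because \<open>L\<close> is
        below \<open>u\<close> there and \<open>u\<close> is below the test line.\<close>
      have "L t' \<le> c' * t' + d'" if "y \<le> t'" "t' \<le> z"
        unfolding L_def
      proof (rule affine_le_affine[of _ "max y y'" _ _ _ "min z z'"])
        show "- c * max y y' + - d \<le> c' * max y y' + d'"
        proof (cases "y \<le> y'")
          case True
          then have "L y' \<le> g y'" using ** that by (simp add: g_def)
          then show ?thesis using **(3) True by (simp add: L_def max_def)
        next
          case False
          then have "u y \<le> c' * y + d'" using u_le[of y] that ** by simp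
          then show ?thesis using * False by (simp add: max_def)
        qed
        show "- c * min z z' + - d \<le> c' * min z z' + d'"
        proof (cases "z' \<le> z")
          case True
          then have "L z' \<le> g z'" using ** that by (simp add: g_def)
          then show ?thesis using **(4) True by (simp add: L_def min_def)
        next
          case False
          then have "u z \<le> c' * z + d'" using u_le[of z] that ** by simp
          then show ?thesis using * False by (simp add: min_def)
        qed
      qed (use ** that in auto)
      then show "g t' \<le> c' * t' + d'" using u_le[of t'] ** by (auto simp: g_def)
    qed
    moreover have "V s \<le> g s \<and> g s \<le> W s" if "s \<in> S" for s
      using Vu[OF that] uW[OF that] *(5)[of s] by (auto simp: g_def L_def)
    ultimately have "g \<in> C" by (auto simp: C_def)
    then have "g t \<le> u t" using upper * by auto
    then show "- u t \<le> c * t + d" using * by (auto simp: g_def L_def)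
  qed
  have usc: "\<forall>\<^sub>F t in at x. u t < q" if x: "x \<in> S" and q: "u x < q" for x q
  proof (rule ccontr)
    assume "\<not> ?thesis"
    then have freq: "\<exists>\<^sub>F t in at x. q \<le> u t" by (simp add: frequently_def not_le)
    have evS: "\<forall>\<^sub>F t in at x. t \<in> S" using x S by (auto simp: eventually_at_in_open')
    have "\<exists>\<^sub>F t in at x. q \<le> W t"
      using frequently_eventually_conj[OF freq evS] by (rule frequently_elim1) (use uW in force)
    moreover have "isCont W x" using W x S by (auto simp: continuous_on_eq_continuous_at)
    ultimately have qW: "q \<le> W x" by (rule frequently_le_limit[rotated])
    \<comment> \<open>Raising the value at the single point \<open>x\<close> keeps the function in
      \<open>C\<close>: a test line lies above \<open>u\<close> around an interior \<open>x\<close>,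
      hence above \<open>q\<close> at points tending to \<open>x\<close>, and so above
      \<open>q\<close> at \<open>x\<close> by continuity. The same limit argument for
      \<open>W\<close> gave \<open>q \<le> W x\<close>.\<close>
    define g where "g = u(x := q)"
    have gu: "u s \<le> g s" for s using q by (simp add: g_def)
    have "line_dominated S V g"
    proof (rule line_dominatedI)
      fix y z c d t assume *: "y \<le> z" "{y..z} \<subseteq> S" "g y \<le> c * y + d" "g z \<le> c * z + d"
        "\<And>t. y \<le> t \<Longrightarrow> t \<le> z \<Longrightarrow> V t \<le> c * t + d" "y \<le> t" "t \<le> z"
      have u_le: "u s \<le> c * s + d" if "y \<le> s" "s \<le> z" for s
        using * gu[of y] gu[of z] that
        by - (rule line_dominatedD[OF dom *(1,2) _ _ *(5)], linarith+)
      show "g t \<le> c * t + d"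
      proof (cases "t = x \<and> x \<noteq> y \<and> x \<noteq> z")
        case True
        then have "\<forall>\<^sub>F s in at x. s \<in> {y<..<z}" using * by (intro eventually_at_in_open') auto
        from frequently_eventually_conj[OF freq this]
        have "\<exists>\<^sub>F s in at x. q \<le> c * s + d"
        proof (rule frequently_elim1)
          fix s assume "s \<in> {y<..<z} \<and> q \<le> u s"
          then show "q \<le> c * s + d" using u_le[of s] by simp
        qed
        then have "q \<le> c * x + d" by (intro frequently_le_limit) (auto intro!: continuous_intros)
        then show ?thesis using True by (simp add: g_def)
      next
        case False
        then show ?thesis using * u_le[of t] by (auto simp: g_def split: if_splits)
      qed
    qed
    moreover have "V s \<le> g s \<and> g s \<le> W s" if "s \<in> S" for s
      using Vu[OF that] uW[OF that] qW gu[of s] by (auto simp: g_def)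
    ultimately have "g \<in> C" by (auto simp: C_def)
    then have "g x \<le> u x" using upper x by auto
    then show False using q by (simp add: g_def)
  qed
  have "isCont u x" if "x \<in> S" for x
    unfolding isCont_def
    using usc line_dominated_lower_semicontinuous[OF S that V Vu dom] that
    by (intro order_tendstoI) auto
  then have "continuous_on S u" by (simp add: S continuous_on_eq_continuous_at)
  then show ?thesis using that[OF Vu uW _ dom glue] by blast
qed

section \<open>Convexity and support lines off the obstacle\<close>

text \<open>A maximum principle. If \<open>u\<close> minus the line had a positive maximum, a short
  chord of \<open>u\<close> centred at a maximiser would still clear \<open>V\<close>, so domination
  would give the midpoint inequality there; this is impossible at the leftmost maximiser.\<close>

lemma line_dominated_chord:
  assumes dom: "line_dominated S V u" and yz: "{y..z} \<subseteq> S" "y < z"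
    and u: "continuous_on {y..z} u" and V: "continuous_on {y..z} V"
    and gt: "\<And>t. t \<in> {y..z} \<Longrightarrow> V t < u t"
    and ends: "u y \<le> c * y + d" "u z \<le> c * z + d" and x: "x \<in> {y..z}"
  shows "u x \<le> c * x + d"
proof (rule ccontr)
  assume "\<not> ?thesis"
  define g where "g t = u t - (c * t + d)" for t
  have g: "continuous_on {y..z} g" unfolding g_def by (intro continuous_intros u)
  obtain m where m: "m \<in> {y..z}" "\<And>t. t \<in> {y..z} \<Longrightarrow> g t \<le> g m"
    using continuous_attains_sup[OF _ _ g] yz by auto
  have "g m > 0" using m(2)[OF x] \<open>\<not> u x \<le> c * x + d\<close> by (auto simp: g_def)
  \<comment> \<open>The set of maximisers is compact, so it has a least element; leftmost is what
    makes the value at \<open>s - h\<close> strictly smaller below.\<close>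
  define K where "K = {t \<in> {y..z}. g t = g m}"
  have "closed K" unfolding K_def by (rule continuous_closed_preimage_constant[OF g]) simp
  then have "compact ({y..z} \<inter> K)" by (intro compact_Int_closed) auto
  moreover have "{y..z} \<inter> K = K" by (auto simp: K_def)
  ultimately have "compact K" "K \<noteq> {}" using m by (auto simp: K_def)
  from compact_attains_inf[OF this] obtain s where "s \<in> K" "\<And>t. t \<in> K \<Longrightarrow> s \<le> t"
    by blast
  then have s: "s \<in> {y..z}" "g s = g m" "\<And>t. t \<in> {y..z} \<Longrightarrow> g t = g m \<Longrightarrow> s \<le> t"
    by (auto simp: K_def)
  have "g y \<le> 0" "g z \<le> 0" using ends by (auto simp: g_def)
  then have "s \<noteq> y" "s \<noteq> z" using s(2) \<open>g m > 0\<close> by auto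
  then have sint: "s \<in> {y<..<z}" using s(1) by simp
  \<comment> \<open>Near \<open>s\<close> this level separates \<open>V\<close> from
    \<open>u\<close>, so every chord of \<open>u\<close> over a short interval around
    \<open>s\<close> lies above \<open>V\<close>.\<close>
  define q where "q = (u s + V s) / 2"
  have q: "V s < q" "q < u s" using gt[OF s(1)] by (auto simp: q_def)
  have "isCont u s" "isCont V s"
    using continuous_on_interior[OF u] continuous_on_interior[OF V] sint by simp_all
  then have "\<forall>\<^sub>F t in nhds s. V t < q \<and> q < u t \<and> t \<in> {y<..<z}"
    using q sint
    by (intro eventually_conj order_tendstoD(2)[of V "V s"] order_tendstoD(1)[of u "u s"]
        eventually_nhds_in_open) (auto simp: isCont_def tendsto_at_iff_tendsto_nhds)
  then obtain e where e: "e > 0" "\<And>t. dist t s < e \<Longrightarrow> V t < q \<and> q < u t \<and> t \<in> {y<..<z}"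
    by (auto simp: eventually_nhds_metric)
  define h where "h = e / 2"
  have h: "h > 0" using e by (simp add: h_def)
  have near: "V t < q \<and> q < u t \<and> t \<in> {y<..<z}" if "s - h \<le> t" "t \<le> s + h" for t
    using that e by (auto simp: h_def dist_real_def)
  \<comment> \<open>\<open>k\<close> and \<open>j\<close> are slope and intercept of the line
    through the graph of \<open>u\<close> at \<open>s - h\<close> and \<open>s + h\<close>; at the
    centre \<open>s\<close> it takes the mean of the two values.\<close>
  define k where "k = (u (s + h) - u (s - h)) / (2 * h)"
  have kh: "k * h = (u (s + h) - u (s - h)) / 2" using h by (simp add: k_def)
  define j where "j = (u (s + h) + u (s - h)) / 2 - k * s"
  have line: "k * (s - h) + j = u (s - h)" "k * (s + h) + j = u (s + h)"
    by (simp_all only: j_def right_diff_distrib distrib_left kh) (simp_all add: field_simps)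
  have "q \<le> k * t + j" if "s - h \<le> t" "t \<le> s + h" for t
  proof -
    have "q < u (s - h)" "q < u (s + h)" using near[of "s - h"] near[of "s + h"] h by auto
    then show ?thesis using affine_le_affine[of 0 "s - h" q k j "s + h" t] line that by simp
  qed
  then have V_le: "V t \<le> k * t + j" if "s - h \<le> t" "t \<le> s + h" for t
    using near[OF that] \<open>\<And>t. s - h \<le> t \<Longrightarrow> t \<le> s + h \<Longrightarrow> q \<le> k * t + j\<close>[OF that] by linarith
  have sub: "{s - h..s + h} \<subseteq> S"
  proof
    fix t assume "t \<in> {s - h..s + h}"
    then show "t \<in> S" using near[of t] yz(1) by auto
  qed
  have "u s \<le> k * s + j"
    by (rule line_dominatedD[OF dom _ sub _ _ V_le]) (use line h in simp_all)
  also have "\<dots> = (u (s + h) + u (s - h)) / 2" by (simp add: j_def)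
  \<comment> \<open>An affine function satisfies the midpoint relation with equality, so subtracting
    it carries the inequality from \<open>u\<close> to \<open>g\<close>.\<close>
  finally have "2 * g s \<le> g (s + h) + g (s - h)" by (simp add: g_def algebra_simps)
  moreover have "s + h \<in> {y..z}" using near[of "s + h"] h by simp
  then have "g (s + h) \<le> g m" by (rule m(2))
  moreover have "g (s - h) < g m"
  proof -
    have "s - h \<in> {y..z}" using near[of "s - h"] h by simp
    then have "g (s - h) \<le> g m" "g (s - h) = g m \<Longrightarrow> s \<le> s - h" using m(2) s(3) by blast+
    then show ?thesis using h by (cases "g (s - h) = g m") auto
  qed
  ultimately show False using s(2) by linarith
qed

text \<open>The chord bound with the barycentric weights that occur in
  \<open>subharmonic_on\<close>.\<close>

lemma line_dominated_convex:
  assumes dom: "line_dominated S V u" and yz: "{y..z} \<subseteq> S" "y < z"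
    and u: "continuous_on {y..z} u" and V: "continuous_on {y..z} V"
    and gt: "\<And>t. t \<in> {y..z} \<Longrightarrow> V t < u t" and x: "y \<le> x" "x \<le> z"
  shows "u x \<le> u y * ((z - x) / (z - y)) + u z * ((x - y) / (z - y))"
proof -
  define c where "c = (u z - u y) / (z - y)"
  have c: "c * (z - y) = u z - u y" using yz by (simp add: c_def)
  have "u x \<le> c * x + (u y - c * y)"
    by (rule line_dominated_chord[OF dom yz u V gt]) (use c x in \<open>auto simp: algebra_simps\<close>)
  also have "\<dots> = u y + c * (x - y)" by (simp add: algebra_simps)
  also have "\<dots> = u y + (u z - u y) * ((x - y) / (z - y))" by (simp add: c_def)
  also have "\<dots> = u y * (1 - (x - y) / (z - y)) + u z * ((x - y) / (z - y))"
    by (simp only: left_diff_distrib right_diff_distrib)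
  also have "1 - (x - y) / (z - y) = (z - x) / (z - y)" using yz by (simp add: field_simps)
  finally show ?thesis .
qed

lemma line_dominated_convex_on:
  assumes dom: "line_dominated S V u" and J: "convex J" "J \<subseteq> S"
    and u: "continuous_on J u" and V: "continuous_on J V"
    and gt: "\<And>t. t \<in> J \<Longrightarrow> V t < u t"
  shows "convex_on J u"
proof (rule convex_on_linorderI)
  fix t x y :: real assume t: "0 < t" "t < 1" and xy: "x \<in> J" "y \<in> J" "x < y"
  define w where "w = (1 - t) * x + t * y"
  have sub: "{x..y} \<subseteq> J"
    using J xy by (metis closed_segment_eq_real_ivl1 closed_segment_subset less_imp_le)
  have w1: "w - x = t * (y - x)" and w2: "y - w = (1 - t) * (y - x)"
    by (auto simp: w_def algebra_simps)
  have "0 \<le> w - x" "0 \<le> y - w" unfolding w1 w2 using t xy by simp_all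
  then have "u w \<le> u x * ((y - w) / (y - x)) + u y * ((w - x) / (y - x))"
    using sub J xy gt
    by (intro line_dominated_convex[OF dom] continuous_on_subset[OF u] continuous_on_subset[OF V]) auto
  also have "\<dots> = (1 - t) * u x + t * u y" unfolding w1 w2 using xy by simp
  finally show "u ((1 - t) *\<^sub>R x + t *\<^sub>R y) \<le> (1 - t) * u x + t * u y" by (simp add: w_def)
qed (rule J)

text \<open>\<open>u\<close> is convex on the component of \<open>{V < u}\<close> around
  \<open>x\<close>, so its right derivative at \<open>x\<close> serves as slope. The support
  inequality is local to that component, whence the condition on the segment.\<close>

lemma line_dominated_support_line:
  assumes "open S" "x \<in> S" and V: "continuous_on S V" and u: "continuous_on S u"
    and dom: "line_dominated S V u" and "V x < u x"
  obtains c where "\<And>t. closed_segment x t \<subseteq> {s \<in> S. V s < u s} \<Longrightarrow> u x + c * (t - x) \<le> u t"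
proof -
  define A where "A = {s \<in> S. V s < u s}"
  have "open (S \<inter> (\<lambda>s. u s - V s) -` {0<..})"
    using assms by (intro continuous_open_preimage) (auto intro!: continuous_intros)
  moreover have "S \<inter> (\<lambda>s. u s - V s) -` {0<..} = A" by (auto simp: A_def)
  ultimately have "open A" by simp
  define J where "J = connected_component_set A x"
  have "open J" "J \<subseteq> A" "convex J"
    using \<open>open A\<close> connected_connected_component[of A x]
    by (auto simp: J_def open_connected_component connected_component_subset connected_convex_1)
  have "x \<in> J" using assms by (auto simp: J_def A_def)
  have "convex_on J u"
    using \<open>J \<subseteq> A\<close> \<open>convex J\<close>
    by (intro line_dominated_convex_on[OF dom] continuous_on_subset[OF u] continuous_on_subset[OF V])
      (auto simp: A_def)
  show ?thesis
  proof (rule that)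
    fix t assume "closed_segment x t \<subseteq> {s \<in> S. V s < u s}"
    then have "closed_segment x t \<subseteq> J"
      unfolding J_def A_def by (intro connected_component_maximal) auto
    then have "t \<in> J" by auto
    \<comment> \<open>The infimum of the difference quotients to the right is the right derivative
      of the convex function \<open>u\<close> at \<open>x\<close>.\<close>
    then show "u x + Inf ((\<lambda>s. (u x - u s) / (x - s)) ` ({x<..} \<inter> J)) * (t - x) \<le> u t"
      using \<open>x \<in> J\<close> \<open>open J\<close> \<open>convex_on J u\<close>
      by (intro convex_le_Inf_differential) (auto simp: interior_open)
  qed
qed

section \<open>Contact points and constrained biconjugates\<close>

text \<open>Intermediate value theorem for \<open>f\<close> minus the line; absence of contact also
  at \<open>x\<close> and \<open>t\<close> makes the conclusion strict.\<close>

lemma no_contact_below: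
  fixes f :: "real \<Rightarrow> real"
  assumes f: "continuous_on (closed_segment x t) f" and "f x \<le> p"
    and no: "\<And>s. s \<in> closed_segment x t \<Longrightarrow> f s - p \<noteq> c * (s - x)"
  shows "f t < p + c * (t - x)"
proof (rule ccontr)
  assume *: "\<not> ?thesis"
  define g where "g s = f s - p - c * (s - x)" for s
  have "connected (g ` closed_segment x t)"
    unfolding g_def using f by (intro connected_continuous_image continuous_intros) auto
  moreover have "g x \<in> g ` closed_segment x t" "g t \<in> g ` closed_segment x t" by auto
  moreover have "g x \<le> 0" "0 \<le> g t" using assms * by (auto simp: g_def)
  ultimately have "0 \<in> g ` closed_segment x t" by (rule connectedD_interval)
  then show False using no by (auto simp: g_def)
qed

lemma no_contact_above:
  fixes f :: "real \<Rightarrow> real"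
  assumes f: "continuous_on (closed_segment x t) f" and "p \<le> f x"
    and no: "\<And>s. s \<in> closed_segment x t \<Longrightarrow> f s - p \<noteq> c * (s - x)"
  shows "p + c * (t - x) < f t"
proof -
  have "- f t < - p + (- c) * (t - x)"
    by (rule no_contact_below) (use assms in \<open>force intro!: continuous_intros\<close>)+
  then show ?thesis by simp
qed

text \<open>The contacts on a compact segment form a compact set, on which the distance to
  \<open>x\<close> attains its minimum. With segments instead of intervals this yields both left and
  right contacts.\<close>

lemma nearest_contact:
  fixes f :: "real \<Rightarrow> real"
  assumes f: "continuous_on (closed_segment x w) f"
    and ex: "t \<in> closed_segment x w" "f t - p = c * (t - x)"
  obtains s where "s \<in> closed_segment x w" "f s - p = c * (s - x)"
    "\<And>t. t \<in> closed_segment x s \<Longrightarrow> t \<noteq> s \<Longrightarrow> f t - p \<noteq> c * (t - x)"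
proof -
  define K where "K = {s \<in> closed_segment x w. f s - c * (s - x) = p}"
  have "closed K" unfolding K_def
    using f by (intro continuous_closed_preimage_constant continuous_intros) auto
  then have "compact (closed_segment x w \<inter> K)" by (intro compact_Int_closed) auto
  moreover have "closed_segment x w \<inter> K = K" by (auto simp: K_def)
  ultimately have "compact K" by simp
  moreover have "K \<noteq> {}" using ex by (auto simp: K_def algebra_simps)
  moreover have "continuous_on K (dist x)" by (intro continuous_intros)
  ultimately obtain s where s: "s \<in> K" "\<And>t. t \<in> K \<Longrightarrow> dist x s \<le> dist x t"
    using continuous_attains_inf by metis
  show ?thesis
  proof (rule that)
    show "s \<in> closed_segment x w" "f s - p = c * (s - x)"
      using s by (auto simp: K_def algebra_simps)
    fix t assume t: "t \<in> closed_segment x s" "t \<noteq> s"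
    then have "dist x t < dist x s"
      by (auto simp: closed_segment_eq_real_ivl dist_real_def split: if_splits)
    then have "t \<notin> K" using s(2)[of t] by auto
    moreover have "t \<in> closed_segment x w"
      using t \<open>s \<in> closed_segment x w\<close> by (meson closed_segment_subset convex_closed_segment ends_in_segment(1) subsetD)
    ultimately show "f t - p \<noteq> c * (t - x)" by (auto simp: K_def algebra_simps)
  qed
qed

text \<open>By continuity the supremum is attained whenever a contact exists. A genuine contact is
  positive, so the default value 0 signals exactly its absence.\<close>

lemma left_contact_cases:
  assumes f: "continuous_on {0<..} f" and "0 < x"
  obtains (none) "left_contact f x c p = 0" "\<And>z. 0 < z \<Longrightarrow> z \<le> x \<Longrightarrow> f z - p \<noteq> c * (z - x)"
  | (some) l where "left_contact f x c p = l" "0 < l" "l \<le> x" "f l - p = c * (l - x)"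
      "\<And>z. l < z \<Longrightarrow> z \<le> x \<Longrightarrow> f z - p \<noteq> c * (z - x)"
proof (cases "\<exists>z. 0 < z \<and> z \<le> x \<and> f z - p = c * (z - x)")
  case False
  then show ?thesis by (intro none) (auto simp: left_contact_def)
next
  case True
  then obtain z where z: "0 < z" "z \<le> x" "f z - p = c * (z - x)" by blast
  have cs: "closed_segment x y = {y..x}" if "y \<le> x" for y
    using that by (auto simp: closed_segment_eq_real_ivl)
  have "continuous_on (closed_segment x z) f"
    using z by (intro continuous_on_subset[OF f]) (auto simp: cs)
  from nearest_contact[OF this _ z(3)] obtain l where l: "z \<le> l" "l \<le> x" "f l - p = c * (l - x)"
    "\<And>t. t \<in> closed_segment x l \<Longrightarrow> t \<noteq> l \<Longrightarrow> f t - p \<noteq> c * (t - x)"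
    using z by (auto simp: cs)
  have no: "f t - p \<noteq> c * (t - x)" if "l < t" "t \<le> x" for t
    using l(4)[of t] l(2) that by (auto simp: cs)
  let ?Z = "{z. 0 < z \<and> z \<le> x \<and> f z - p = c * (z - x)}"
  have "Sup ?Z = l"
  proof (rule cSup_eq_maximum)
    show "l \<in> ?Z" using z l(1-3) by auto
    show "t \<le> l" if "t \<in> ?Z" for t using that no[of t] by (cases "l < t") auto
  qed
  moreover have "?Z \<noteq> {}" using z by blast
  ultimately have "left_contact f x c p = l" by (simp only: left_contact_def Let_def if_False)
  then show ?thesis by (rule some[of l]) (use z l(1-3) no in simp_all)
qed

lemma right_contact_cases:
  assumes f: "continuous_on {0<..} f" and "0 < x"
  obtains (none) "right_contact f x c p = \<infinity>" "\<And>z. x \<le> z \<Longrightarrow> f z - p \<noteq> c * (z - x)"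
  | (some) l where "right_contact f x c p = ereal l" "x \<le> l" "f l - p = c * (l - x)"
      "\<And>z. x \<le> z \<Longrightarrow> z < l \<Longrightarrow> f z - p \<noteq> c * (z - x)"
proof (cases "\<exists>z. x \<le> z \<and> f z - p = c * (z - x)")
  case False
  then have "{y. x \<le> y \<and> f y - p = c * (y - x)} = {}" by blast
  then have "right_contact f x c p = \<infinity>" by (simp only: right_contact_def image_empty Inf_empty top_ereal_def)
  then show ?thesis using False by (intro none) auto
next
  case True
  then obtain z where z: "x \<le> z" "f z - p = c * (z - x)" by blast
  have cs: "closed_segment x y = {x..y}" if "x \<le> y" for y
    using that by (auto simp: closed_segment_eq_real_ivl)
  have "continuous_on (closed_segment x z) f"
    using z assms by (intro continuous_on_subset[OF f]) (auto simp: cs)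
  from nearest_contact[OF this _ z(2)] obtain l where l: "l \<le> z" "x \<le> l" "f l - p = c * (l - x)"
    "\<And>t. t \<in> closed_segment x l \<Longrightarrow> t \<noteq> l \<Longrightarrow> f t - p \<noteq> c * (t - x)"
    using z by (auto simp: cs)
  have no: "f t - p \<noteq> c * (t - x)" if "t < l" "x \<le> t" for t
    using l(4)[of t] l(2) that by (auto simp: cs)
  have "right_contact f x c p = ereal l"
    unfolding right_contact_def
  proof (rule antisym)
    show "(INF y\<in>{y. x \<le> y \<and> f y - p = c * (y - x)}. ereal y) \<le> ereal l"
      using l by (intro INF_lower) auto
    show "ereal l \<le> (INF y\<in>{y. x \<le> y \<and> f y - p = c * (y - x)}. ereal y)"
      using no by (intro INF_greatest) (auto simp: not_less[symmetric])
  qed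
  then show ?thesis by (rule some[of l]) (use l(1-3) no in simp_all)
qed

lemma le_left_contact:
  assumes f: "continuous_on {0<..} f" and x: "0 < x"
    and s: "0 < s" "s \<le> x" "f s - p = c * (s - x)"
  shows "s \<le> left_contact f x c p"
proof (cases rule: left_contact_cases[OF f x, of c p])
  case 1
  from 1(2)[OF s(1,2)] s(3) show ?thesis by simp
next
  case (2 l)
  from 2(5)[of s] 2(1) s show ?thesis by (cases "l < s") auto
qed

lemma right_contact_le:
  assumes f: "continuous_on {0<..} f" and x: "0 < x"
    and s: "x \<le> s" "f s - p = c * (s - x)"
  shows "right_contact f x c p \<le> ereal s"
proof (cases rule: right_contact_cases[OF f x, of c p])
  case 1
  from 1(2)[OF s(1)] s(2) show ?thesis by simp
next
  case (2 l)
  from 2(4)[of s] 2(1) s show ?thesis by (cases "s < l") auto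
qed

lemma contact_at_base:
  assumes f: "continuous_on {0<..} f" and x: "0 < x" and p: "f x = p"
  shows "left_contact f x c p = x" "right_contact f x c p = ereal x"
proof -
  show "left_contact f x c p = x"
  proof (cases rule: left_contact_cases[OF f x, of c p])
    case 1
    from 1(2)[of x] x p show ?thesis by simp
  next
    case (2 l)
    from 2(5)[of x] 2(1,3) p show ?thesis by (cases "l < x") auto
  qed
  show "right_contact f x c p = ereal x"
  proof (cases rule: right_contact_cases[OF f x, of c p])
    case 1
    from 1(2)[of x] x p show ?thesis by simp
  next
    case (2 l)
    from 2(4)[of x] 2(1,2) p show ?thesis by (cases "x < l") auto
  qed
qed

section \<open>The lower biconjugate of a taut string\<close>

text \<open>The gap conditions ask only for suitable points arbitrarily near each end, not for
  limits. An absolute bound near 0 and a bound relative to \<open>z\<close> at infinity are what a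
  small affine correction of a line can absorb.\<close>

locale taut_string =
  fixes V W u :: "real \<Rightarrow> real"
  assumes V_continuous: "continuous_on {0<..} V" and W_continuous: "continuous_on {0<..} W"
    and u_continuous: "continuous_on {0<..} u"
    and V_le_u: "\<And>x. 0 < x \<Longrightarrow> V x \<le> u x" and u_le_W: "\<And>x. 0 < x \<Longrightarrow> u x \<le> W x"
    and dominated_V: "line_dominated {0<..} V u"
    and dominated_W: "line_dominated {0<..} (\<lambda>x. - W x) (\<lambda>x. - u x)"
    and gap_zero: "\<And>x e. 0 < x \<Longrightarrow> 0 < e \<Longrightarrow> \<exists>y. 0 < y \<and> y \<le> x \<and> W y - V y \<le> e"
    and gap_infinity: "\<And>x e. 0 < x \<Longrightarrow> 0 < e \<Longrightarrow> \<exists>z\<ge>x. W z - V z \<le> e * z"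
begin

lemma segment_continuous:
  assumes "0 < x" "0 < t"
  shows "continuous_on (closed_segment x t) V" "continuous_on (closed_segment x t) W"
    "continuous_on (closed_segment x t) u"
  using assms
  by (auto intro!: continuous_on_subset[OF V_continuous] continuous_on_subset[OF W_continuous]
      continuous_on_subset[OF u_continuous] simp: closed_segment_eq_real_ivl)

lemma left_no_contact:
  assumes "0 < x" "p \<le> W x" "0 < y" "left_contact W x c p < y" "y \<le> x"
  shows "p + c * (y - x) < W y"
proof (rule no_contact_above)
  fix s assume "s \<in> closed_segment x y"
  then have "y \<le> s" "s \<le> x" using assms by (auto simp: closed_segment_eq_real_ivl split: if_splits)
  then show "W s - p \<noteq> c * (s - x)"
    using assms by (cases rule: left_contact_cases[OF W_continuous \<open>0 < x\<close>, of c p]) auto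
qed (use assms segment_continuous in auto)

lemma right_no_contact:
  assumes "0 < x" "p \<le> W x" "ereal y < right_contact W x c p" "x \<le> y"
  shows "p + c * (y - x) < W y"
proof (rule no_contact_above)
  fix s assume "s \<in> closed_segment x y"
  then have "s \<le> y" "x \<le> s" using assms by (auto simp: closed_segment_eq_real_ivl split: if_splits)
  then show "W s - p \<noteq> c * (s - x)"
    using assms by (cases rule: right_contact_cases[OF W_continuous \<open>0 < x\<close>, of c p]) auto
qed (use assms segment_continuous in auto)

text \<open>\<open>V\<close> starts at or below the line at \<open>x\<close> and cannot cross it
  before the first contact. Hence every value that enters the lower biconjugate is at most the
  height \<open>p\<close> of its line at \<open>x\<close>.\<close>

lemma below_line_between_contacts:
  assumes "0 < x" "V x \<le> p" "0 < y" "left_contact V x c p \<le> y" "ereal y \<le> right_contact V x c p"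
  shows "V y \<le> p + c * (y - x)"
proof (cases "V y - p = c * (y - x)")
  case False
  have "V y < p + c * (y - x)"
  proof (rule no_contact_below)
    fix s assume s: "s \<in> closed_segment x y"
    show "V s - p \<noteq> c * (s - x)"
    proof (cases "s = y")
      case sy: False
      then consider "x \<le> s" "s < y" | "y < s" "s \<le> x"
        using s by (auto simp: closed_segment_eq_real_ivl split: if_splits)
      then show ?thesis
      proof cases
        case 1
        then show ?thesis using assms
          by (cases rule: right_contact_cases[OF V_continuous \<open>0 < x\<close>, of c p]) auto
      next
        case 2
        then show ?thesis using assms
          by (cases rule: left_contact_cases[OF V_continuous \<open>0 < x\<close>, of c p]) auto
      qed
    qed (use False in simp)
  qed (use assms segment_continuous in auto)
  then show ?thesis by simp
qed auto

text \<open>Between the points used on the two sides the line stays below \<open>W\<close>, so by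
  \<open>dominated_W\<close> it suffices that \<open>u\<close> is above it at these two points. At a
  contact with \<open>V\<close> this is clear; on a side without contact it holds up to a small
  error at a point of small gap, since there \<open>u \<ge> V\<close> and \<open>W\<close> is above
  the line.\<close>

lemma line_le_string:
  assumes x: "0 < x" and p: "V x \<le> p" "p \<le> W x"
    and lc: "left_contact W x c p \<le> left_contact V x c p"
    and rc: "right_contact V x c p \<le> right_contact W x c p"
  shows "p \<le> u x"
proof (rule field_le_epsilon)
  fix e :: real assume "0 < e"
  \<comment> \<open>Chosen so that lowering the line by \<open>d + d * t\<close> costs exactly
    \<open>e\<close> at \<open>t = x\<close>.\<close>
  define d where "d = e / (1 + x)"
  have "d * (1 + x) = e" using x by (simp add: d_def)
  then have "d + d * x = e" by (simp add: distrib_left)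
  moreover have "0 < d" using \<open>0 < e\<close> x by (simp add: d_def)
  ultimately have d: "0 < d" "d + d * x = e" by simp_all
  have "\<exists>y. 0 < y \<and> y \<le> x \<and> p + c * (y - x) - d \<le> u y \<and>
      (\<forall>t. y \<le> t \<longrightarrow> t \<le> x \<longrightarrow> p + c * (t - x) \<le> W t)"
  proof (cases rule: left_contact_cases[OF V_continuous x, of c p])
    case 1
    \<comment> \<open>Without a contact of \<open>V\<close> on the left,
      \<open>left_contact V x c p\<close> is 0, which forces the left contact of \<open>W\<close> to
      be 0 as well: the line is below \<open>W\<close> all the way to 0, and \<open>y\<close> may be
      taken where the gap is small.\<close>
    obtain y where y: "0 < y" "y \<le> x" "W y - V y \<le> d" using gap_zero[OF x d(1)] by blast
    have "p + c * (t - x) < W t" if "y \<le> t" "t \<le> x" for t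
      using 1 lc y that x p by (intro left_no_contact) auto
    then show ?thesis using y V_le_u[of y] by (intro exI[of _ y]) (force intro: less_imp_le)
  next
    case (2 l)
    have "p + c * (t - x) \<le> W t" if "l \<le> t" "t \<le> x" for t
    proof (cases "t = l")
      case True
      then show ?thesis using 2 V_le_u[of l] u_le_W[of l] by auto
    next
      case False
      then show ?thesis using 2 lc that x p by (intro less_imp_le[OF left_no_contact]) auto
    qed
    then show ?thesis using 2 V_le_u[of l] d by (intro exI[of _ l]) auto
  qed
  then obtain y where y: "0 < y" "y \<le> x" "p + c * (y - x) - d \<le> u y"
    "\<And>t. y \<le> t \<Longrightarrow> t \<le> x \<Longrightarrow> p + c * (t - x) \<le> W t" by blast
  have "\<exists>z\<ge>x. p + c * (z - x) - d * z \<le> u z \<and>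
      (\<forall>t. x \<le> t \<longrightarrow> t \<le> z \<longrightarrow> p + c * (t - x) \<le> W t)"
  proof (cases rule: right_contact_cases[OF V_continuous x, of c p])
    case 1
    obtain z where z: "x \<le> z" "W z - V z \<le> d * z" using gap_infinity[OF x d(1)] by blast
    have "p + c * (t - x) < W t" if "x \<le> t" "t \<le> z" for t
      using 1 rc z that x p by (intro right_no_contact) auto
    then show ?thesis using z x V_le_u[of z] by (intro exI[of _ z]) (force intro: less_imp_le)
  next
    case (2 l)
    have "p + c * (t - x) \<le> W t" if "x \<le> t" "t \<le> l" for t
    proof (cases "t = l")
      case True
      then show ?thesis using 2 x V_le_u[of l] u_le_W[of l] by auto
    next
      case False
      then have "ereal t < right_contact V x c p" using 2 that by auto
      then have "ereal t < right_contact W x c p" using rc by (rule less_le_trans)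
      then show ?thesis using that x p by (intro less_imp_le[OF right_no_contact]) auto
    qed
    moreover have "0 \<le> d * l" using d 2 x by auto
    ultimately show ?thesis using 2 x V_le_u[of l] by (intro exI[of _ l]) auto
  qed
  then obtain z where z: "x \<le> z" "p + c * (z - x) - d * z \<le> u z"
    "\<And>t. x \<le> t \<Longrightarrow> t \<le> z \<Longrightarrow> p + c * (t - x) \<le> W t" by blast
  have pos: "0 \<le> d * t" if "0 < t" for t using d that by simp
  have W: "p + c * (t - x) \<le> W t" if "y \<le> t" "t \<le> z" for t
    using y(4)[of t] z(3)[of t] that by (cases "t \<le> x") auto
  \<comment> \<open>The lowered line, negated to fit \<open>dominated_W\<close>. The constant
    \<open>d\<close> absorbs the error at \<open>y\<close>, the slope term \<open>d * t\<close> the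
    error at \<open>z\<close>.\<close>
  have eq: "(d - c) * t + (d - p + c * x) = - (p + c * (t - x) - d - d * t)" for t
    by (simp add: algebra_simps)
  have "- u x \<le> (d - c) * x + (d - p + c * x)"
  proof (rule line_dominatedD[OF dominated_W])
    show "{y..z} \<subseteq> {0<..}" using y by auto
    show "- u y \<le> (d - c) * y + (d - p + c * x)" unfolding eq using y pos[of y] by simp
    show "- u z \<le> (d - c) * z + (d - p + c * x)" unfolding eq using x d z by simp
    show "- W t \<le> (d - c) * t + (d - p + c * x)" if "y \<le> t" "t \<le> z" for t
    proof -
      have "0 \<le> d * t" by (rule pos) (use y(1) that in linarith)
      then show ?thesis unfolding eq using W[OF that] d(1) by linarith
    qed
  qed (use y z in auto)
  then show "p \<le> u x + e" unfolding eq using d by simp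
qed

lemma lower_biconjugate_le:
  assumes "0 < x"
  shows "lower_biconjugate V W x \<le> ereal (u x)"
  unfolding lower_biconjugate_def
proof (intro SUP_least)
  fix c y assume "y \<in> lower_domain V W x c"
  then obtain p where p: "V x \<le> p" "p \<le> W x" "0 < y" "left_contact W x c p \<le> left_contact V x c p"
    "left_contact V x c p \<le> y" "ereal y \<le> right_contact V x c p"
    "right_contact V x c p \<le> right_contact W x c p"
    by (auto simp: lower_domain_def)
  have "V y \<le> p + c * (y - x)" using assms p by (intro below_line_between_contacts) auto
  moreover have "p \<le> u x" using assms p by (intro line_le_string)
  ultimately show "ereal (c * (x - y) + V y) \<le> ereal (u x)" by (simp add: algebra_simps)
qed

lemma lower_biconjugate_ge_value:
  assumes "V x \<le> p" "p \<le> W x" "left_contact W x c p \<le> left_contact V x c p" "0 < y"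
    "left_contact V x c p \<le> y" "ereal y \<le> right_contact V x c p"
    "right_contact V x c p \<le> right_contact W x c p"
  shows "ereal (c * (x - y) + V y) \<le> lower_biconjugate V W x"
proof -
  have "y \<in> lower_domain V W x c" unfolding lower_domain_def using assms by auto
  then show ?thesis unfolding lower_biconjugate_def by (intro SUP_upper2[of c] SUP_upper) auto
qed

text \<open>Suppose the lowered support line reaches \<open>W\<close> at \<open>w\<close> without
  meeting \<open>V\<close>. Then \<open>V\<close> stays below it, while \<open>u\<close> starts
  above it and is at most \<open>W w\<close> at \<open>w\<close>, so \<open>u\<close> meets it at
  some first \<open>s\<close>. Up to \<open>s\<close> the string is off \<open>V\<close>, so the
  support inequality holds at \<open>s\<close> and contradicts the lowering.\<close>

lemma support_line_contacts_V_first: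
  assumes x: "0 < x" and p: "V x < p" "p < u x" and w: "0 < w"
    and c: "\<And>t. closed_segment x t \<subseteq> {s \<in> {0<..}. V s < u s} \<Longrightarrow> u x + c * (t - x) \<le> u t"
    and contact: "W w - p = c * (w - x)"
  shows "\<exists>s\<in>closed_segment x w. V s - p = c * (s - x)"
proof (rule ccontr)
  assume "\<not> ?thesis"
  then have no: "V s - p \<noteq> c * (s - x)" if "s \<in> closed_segment x w" for s using that by blast
  have V: "V s < p + c * (s - x)" if "s \<in> closed_segment x w" for s
  proof (rule no_contact_below)
    have "closed_segment x s \<subseteq> closed_segment x w"
      using that by (meson closed_segment_subset convex_closed_segment ends_in_segment(1))
    then show "V t - p \<noteq> c * (t - x)" if "t \<in> closed_segment x s" for t
      using no that by blast
    show "continuous_on (closed_segment x s) V"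
      using x w that by (intro segment_continuous) (auto simp: closed_segment_eq_real_ivl split: if_splits)
  qed (use p in auto)
  have "\<exists>t\<in>closed_segment x w. u t - p = c * (t - x)"
  proof (rule ccontr)
    assume "\<not> ?thesis"
    then have "p + c * (w - x) < u w"
      using segment_continuous[OF x w] p by (intro no_contact_above) auto
    then show False using contact u_le_W[OF w] by simp
  qed
  \<comment> \<open>The contact of \<open>u\<close> nearest to \<open>x\<close>: before it
    \<open>u\<close> is above the line and therefore above \<open>V\<close>.\<close>
  then obtain s where s: "s \<in> closed_segment x w" "u s - p = c * (s - x)"
    "\<And>t. t \<in> closed_segment x s \<Longrightarrow> t \<noteq> s \<Longrightarrow> u t - p \<noteq> c * (t - x)"
    using nearest_contact[OF segment_continuous(3)[OF x w]] by metis
  have "closed_segment x s \<subseteq> closed_segment x w"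
    using s by (meson closed_segment_subset convex_closed_segment ends_in_segment(1))
  have "closed_segment x s \<subseteq> {s \<in> {0<..}. V s < u s}"
  proof
    fix t assume t: "t \<in> closed_segment x s"
    then have tw: "t \<in> closed_segment x w" using \<open>closed_segment x s \<subseteq> closed_segment x w\<close> by blast
    then have "0 < t" using x w by (auto simp: closed_segment_eq_real_ivl split: if_splits)
    moreover have "p + c * (t - x) \<le> u t"
    proof (cases "t = s")
      case False
      have "p + c * (t - x) < u t"
      proof (rule no_contact_above)
        fix t' assume "t' \<in> closed_segment x t"
        then have "t' \<in> closed_segment x s" "t' \<noteq> s"
          using t False by (auto simp: closed_segment_eq_real_ivl split: if_splits)
        then show "u t' - p \<noteq> c * (t' - x)" by (rule s(3))
      qed (use p x \<open>0 < t\<close> segment_continuous in auto)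
      then show ?thesis by simp
    qed (use s in simp)
    ultimately show "t \<in> {s \<in> {0<..}. V s < u s}" using V[OF tw] by simp
  qed
  from c[OF this] show False using s(2) p by simp
qed

text \<open>Where \<open>u\<close> touches \<open>V\<close>, the point \<open>x\<close> itself is a
  contact and any slope will do. Elsewhere a support line lowered by \<open>d\<close> is admissible;
  a contact with \<open>V\<close> gives the value \<open>u x - d\<close>, and without contacts a
  point of small gap near 0 gives almost as much.\<close>

lemma lower_biconjugate_ge:
  assumes x: "0 < x"
  shows "ereal (u x) \<le> lower_biconjugate V W x"
proof (cases "u x = V x")
  case True
  have "left_contact V x 0 (V x) = x" "right_contact V x 0 (V x) = ereal x"
    using contact_at_base[OF V_continuous x] by simp_all
  moreover have "left_contact W x 0 (V x) \<le> x"
    by (cases rule: left_contact_cases[OF W_continuous x, of 0 "V x"]) (use x in auto)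
  moreover have "ereal x \<le> right_contact W x 0 (V x)"
    by (cases rule: right_contact_cases[OF W_continuous x, of 0 "V x"]) auto
  ultimately have "ereal (0 * (x - x) + V x) \<le> lower_biconjugate V W x"
    using x V_le_u[OF x] u_le_W[OF x] by (intro lower_biconjugate_ge_value[where p = "V x"]) auto
  then show ?thesis using True by simp
next
  case False
  then have "V x < u x" using V_le_u[OF x] by simp
  obtain c where c: "\<And>t. closed_segment x t \<subseteq> {s \<in> {0<..}. V s < u s} \<Longrightarrow> u x + c * (t - x) \<le> u t"
    using line_dominated_support_line[OF _ _ V_continuous u_continuous dominated_V \<open>V x < u x\<close>] x by auto
  show ?thesis
  proof (rule ereal_le_epsilon2)
    fix e :: real assume "0 < e"
    \<comment> \<open>At most \<open>e / 2\<close> because \<open>d\<close> can be lost twice, by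
      lowering the line and through the gap; smaller than \<open>u x - V x\<close> so that
      \<open>p\<close> stays above \<open>V x\<close>.\<close>
    define d where "d = min (e / 2) ((u x - V x) / 2)"
    have d: "0 < d" "d \<le> e / 2" "d < u x - V x"
      using \<open>0 < e\<close> \<open>V x < u x\<close> by (auto simp: d_def min_def)
    define p where "p = u x - d"
    have p: "V x < p" "p < u x" "V x \<le> p" "p \<le> W x" using d u_le_W[OF x] by (auto simp: p_def)
    have first: "\<exists>s\<in>closed_segment x w. V s - p = c * (s - x)"
      if "0 < w" "W w - p = c * (w - x)" for w
      by (rule support_line_contacts_V_first[OF x p(1,2) that(1) _ that(2)]) (rule c)
    have lc: "left_contact W x c p \<le> left_contact V x c p"
    proof (cases rule: left_contact_cases[OF W_continuous x, of c p])
      case 1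
      then show ?thesis by (cases rule: left_contact_cases[OF V_continuous x, of c p]) auto
    next
      case (2 w)
      then obtain s where s: "s \<in> closed_segment x w" "V s - p = c * (s - x)"
        using first[OF 2(2,4)] by blast
      then have sw: "w \<le> s" "s \<le> x" using 2(3) by (auto simp: closed_segment_eq_real_ivl split: if_splits)
      then have "s \<le> left_contact V x c p"
        using 2(2) s(2) by (intro le_left_contact[OF V_continuous x]) simp_all
      then show ?thesis using sw 2(1) by simp
    qed
    have rc: "right_contact V x c p \<le> right_contact W x c p"
    proof (cases rule: right_contact_cases[OF W_continuous x, of c p])
      case (2 w)
      then have "0 < w" using x by simp
      obtain s where s: "s \<in> closed_segment x w" "V s - p = c * (s - x)"
        using first[OF \<open>0 < w\<close> 2(3)] by blast
      then have sw: "s \<le> w" "x \<le> s" using 2(2) by (auto simp: closed_segment_eq_real_ivl split: if_splits)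
      then have "right_contact V x c p \<le> ereal s"
        using s(2) by (intro right_contact_le[OF V_continuous x]) simp_all
      also have "\<dots> \<le> right_contact W x c p" using sw 2(1) by simp
      finally show ?thesis .
    qed simp
    note ge = lower_biconjugate_ge_value[OF p(3,4) lc _ _ _ rc]
    have "ereal (u x - e) \<le> lower_biconjugate V W x"
    proof (cases rule: left_contact_cases[OF V_continuous x, of c p])
      case (2 l)
      have "ereal l \<le> right_contact V x c p"
        using 2 by (cases rule: right_contact_cases[OF V_continuous x, of c p]) auto
      then have "ereal (c * (x - l) + V l) \<le> lower_biconjugate V W x"
        using 2 by (intro ge) auto
      moreover have "c * (x - l) + V l = p" using 2 by (simp add: algebra_simps)
      ultimately show ?thesis using d by (auto simp: p_def elim!: order_trans[rotated])
    next
      case l: 1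
      show ?thesis
      proof (cases rule: right_contact_cases[OF V_continuous x, of c p])
        case (2 r)
        then have "ereal (c * (x - r) + V r) \<le> lower_biconjugate V W x"
          using l x by (intro ge) auto
        moreover have "c * (x - r) + V r = p" using 2 by (simp add: algebra_simps)
        ultimately show ?thesis using d by (auto simp: p_def elim!: order_trans[rotated])
      next
        case 1
        \<comment> \<open>With no contact on either side the domain contains all of
          \<open>(0, \<infinity>)\<close>. The line is below \<open>W\<close> on the left, so at
          \<open>y\<close> it exceeds \<open>V\<close> by less than \<open>d\<close>.\<close>
        obtain y where y: "0 < y" "y \<le> x" "W y - V y \<le> d" using gap_zero[OF x d(1)] by blast
        have "p + c * (y - x) < W y" using x y p lc l by (intro left_no_contact) auto
        then have "u x - e \<le> c * (x - y) + V y" using y d by (simp add: p_def algebra_simps)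
        moreover have "ereal (c * (x - y) + V y) \<le> lower_biconjugate V W x"
          using l 1 y by (intro ge) auto
        ultimately show ?thesis by (auto elim!: order_trans[rotated])
      qed
    qed
    then show "ereal (u x) \<le> lower_biconjugate V W x + ereal e"
      by (cases "lower_biconjugate V W x") auto
  qed
qed

lemma lower_biconjugate_eq:
  assumes "0 < x"
  shows "lower_biconjugate V W x = ereal (u x)"
  using lower_biconjugate_le lower_biconjugate_ge assms by (intro antisym)

end

section \<open>The upper biconjugate by negation\<close>

lemma left_contact_uminus: "left_contact (\<lambda>x. - f x) x (- c) (- p) = left_contact f x c p"
proof -
  have "(- f z - - p = - c * (z - x)) = (f z - p = c * (z - x))" for z by auto
  then show ?thesis unfolding left_contact_def by (simp only:)
qed

lemma right_contact_uminus: "right_contact (\<lambda>x. - f x) x (- c) (- p) = right_contact f x c p"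
proof -
  have "(- f z - - p = - c * (z - x)) = (f z - p = c * (z - x))" for z by auto
  then show ?thesis unfolding right_contact_def by (simp only:)
qed

lemma lower_domain_uminus: "lower_domain (\<lambda>x. - W x) (\<lambda>x. - V x) x (- c) = upper_domain V W x c"
proof -
  have "{- W x..- V x} = uminus ` {V x..W x}" by simp
  then show ?thesis
    unfolding lower_domain_def upper_domain_def
    by (simp only: image_image SUP_image o_def left_contact_uminus right_contact_uminus)
qed

text \<open>Negation permutes the slopes, so the outer supremum may be reindexed by it; in the
  extended reals this also matches the values for empty inner domains.\<close>

lemma upper_biconjugate_eq_lower:
  "upper_biconjugate V W x = - lower_biconjugate (\<lambda>x. - W x) (\<lambda>x. - V x) x"
proof -
  have "lower_biconjugate (\<lambda>x. - W x) (\<lambda>x. - V x) x =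
      (SUP c\<in>range uminus. SUP y\<in>lower_domain (\<lambda>x. - W x) (\<lambda>x. - V x) x c. ereal (c * (x - y) + - W y))"
    unfolding lower_biconjugate_def by (simp add: surj_uminus)
  also have "\<dots> = (SUP c. SUP y\<in>upper_domain V W x c. - ereal (c * (x - y) + W y))"
    by (simp only: image_image lower_domain_uminus uminus_ereal.simps minus_add_distrib mult_minus_left)
  also have "\<dots> = - upper_biconjugate V W x"
    unfolding upper_biconjugate_def ereal_SUP_uminus_eq ..
  finally show ?thesis by simp
qed

context taut_string
begin

text \<open>Negation exchanges the obstacles, and with them the two domination conditions, and
  leaves the gap unchanged.\<close>

lemma taut_string_uminus: "taut_string (\<lambda>x. - W x) (\<lambda>x. - V x) (\<lambda>x. - u x)"
proof
  show "line_dominated {0<..} (\<lambda>x. - (- V x)) (\<lambda>x. - (- u x))" using dominated_V by simp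
qed (use V_continuous W_continuous u_continuous V_le_u u_le_W dominated_W gap_zero gap_infinity
    in \<open>auto intro!: continuous_intros\<close>)

lemma upper_biconjugate_eq:
  assumes "0 < x"
  shows "upper_biconjugate V W x = ereal (u x)"
  using taut_string.lower_biconjugate_eq[OF taut_string_uminus assms]
  by (simp add: upper_biconjugate_eq_lower)

end

section \<open>Diffusions\<close>

lemma is_interval_einterval: "is_interval (einterval c d)"
  by (auto simp: is_interval_1 einterval_iff) (meson ereal_less_eq(3) le_less_trans less_le_trans)+

context discounted_diffusion
begin

section \<open>Discounted hitting times\<close>

text \<open>Along a continuous path the set of times spent at \<open>y\<close> is closed, so it
  contains its infimum.\<close>

lemma hitting_time_attained:
  assumes "\<omega> \<in> \<Omega>" "hitting_time X (ereal y) \<omega> < \<infinity>"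
  obtains t where "0 \<le> t" "hitting_time X (ereal y) \<omega> = ennreal t" "X t \<omega> = y"
proof -
  define K where "K = {t \<in> {0..}. X t \<omega> = y}"
  have K: "{t. 0 \<le> t \<and> ereal (X t \<omega>) = ereal y} = K" by (auto simp: K_def)
  have "closed K"
    unfolding K_def by (intro continuous_closed_preimage_constant continuous_paths assms) auto
  moreover have "K \<noteq> {}" using assms(2) unfolding hitting_time_def K by auto
  moreover have bdd: "bdd_below K" by (auto simp: K_def)
  ultimately have Inf: "Inf K \<in> K" by (intro closed_contains_Inf)
  have "hitting_time X (ereal y) \<omega> = ennreal (Inf K)"
    unfolding hitting_time_def K
    using Inf bdd by (intro antisym INF_lower INF_greatest ennreal_leI cInf_lower)
  then show ?thesis using Inf that by (auto simp: K_def)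
qed

text \<open>The integrand of \<open>laplace_hitting\<close>; the value 0 on paths that never hit
  \<open>y\<close> is the limit of the discount factor at time infinity.\<close>

definition hitting_discount :: "real \<Rightarrow> 'w \<Rightarrow> real" where
  "hitting_discount y \<omega> = (if hitting_time X (ereal y) \<omega> < \<infinity>
     then exp (- r * enn2real (hitting_time X (ereal y) \<omega>)) else 0)"

lemma integral_hitting_discount:
  assumes "x \<in> einterval a b" "y \<in> einterval a b"
  shows "(\<integral>\<omega>. hitting_discount y \<omega> \<partial>P x) = (if x > y then \<psi> x / \<psi> y else \<phi> x / \<phi> y)"
  using laplace_hitting[OF assms] by (simp add: hitting_discount_def)

text \<open>Integrability, and with it measurability, is read off the Laplace transform: the Bochner
  integral of a non-integrable function is 0 by convention, whereas the given value is
  positive.\<close>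

lemma integrable_hitting_discount:
  assumes "x \<in> einterval a b" "y \<in> einterval a b"
  shows "integrable (P x) (hitting_discount y)"
proof (rule ccontr)
  assume "\<not> ?thesis"
  then have "(\<integral>\<omega>. hitting_discount y \<omega> \<partial>P x) = 0" by (rule not_integrable_integral_eq)
  moreover have "\<phi> x > 0" "\<psi> x > 0" "\<phi> y > 0" "\<psi> y > 0" using assms \<phi>_pos \<psi>_pos by auto
  ultimately show False using integral_hitting_discount[OF assms] by (auto split: if_splits)
qed

text \<open>At the hitting time the product is one of the values of the discounted process.\<close>

lemma hitting_discount_le_sup:
  assumes "\<omega> \<in> \<Omega>"
  shows "ennreal \<bar>f y * hitting_discount y \<omega>\<bar> \<le> (SUP t\<in>{0..}. ennreal \<bar>exp (- r * t) * f (X t \<omega>)\<bar>)"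
proof (cases "hitting_time X (ereal y) \<omega> < \<infinity>")
  case True
  with assms obtain t where "0 \<le> t" "hitting_time X (ereal y) \<omega> = ennreal t" "X t \<omega> = y"
    by (rule hitting_time_attained)
  then show ?thesis
    by (intro SUP_upper2[of t]) (auto simp: hitting_discount_def mult.commute)
qed (simp add: hitting_discount_def)

text \<open>Hitting times of levels leaving every compact set tend to infinity, because each path is
  bounded away from the endpoints up to any finite time.\<close>

lemma hitting_discount_tendsto_zero:
  assumes \<omega>: "\<omega> \<in> \<Omega>"
    and escape: "\<And>K. compact K \<Longrightarrow> K \<subseteq> einterval a b \<Longrightarrow> \<forall>\<^sub>F n in sequentially. Y n \<notin> K"
    and lim: "((\<lambda>t. exp (- r * t) * f (X t \<omega>)) \<longlongrightarrow> 0) at_top"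
  shows "(\<lambda>n. f (Y n) * hitting_discount (Y n) \<omega>) \<longlonglongrightarrow> 0"
proof (rule tendstoI)
  fix e :: real assume "0 < e"
  from tendstoD[OF lim this] obtain T where T: "\<And>t. T \<le> t \<Longrightarrow> \<bar>exp (- r * t) * f (X t \<omega>)\<bar> < e"
    by (auto simp: eventually_at_top_linorder)
  have "compact ((\<lambda>t. X t \<omega>) ` {0..T})"
    by (intro compact_continuous_image continuous_on_subset[OF continuous_paths[OF \<omega>]]) auto
  moreover have "(\<lambda>t. X t \<omega>) ` {0..T} \<subseteq> einterval a b" using state_space \<omega> by auto
  ultimately have "\<forall>\<^sub>F n in sequentially. Y n \<notin> (\<lambda>t. X t \<omega>) ` {0..T}" by (rule escape)
  then show "\<forall>\<^sub>F n in sequentially. dist (f (Y n) * hitting_discount (Y n) \<omega>) 0 < e"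
  proof eventually_elim
    case (elim n)
    show ?case
    proof (cases "hitting_time X (ereal (Y n)) \<omega> < \<infinity>")
      case True
      with \<omega> obtain t where t: "0 \<le> t" "hitting_time X (ereal (Y n)) \<omega> = ennreal t" "X t \<omega> = Y n"
        by (rule hitting_time_attained)
      have "T \<le> t"
      proof (rule ccontr)
        assume "\<not> T \<le> t"
        then have "t \<in> {0..T}" using t by simp
        then show False using elim t(3) by (metis image_eqI)
      qed
      from T[OF this] t show ?thesis by (simp add: hitting_discount_def mult.commute)
    qed (use \<open>0 < e\<close> in \<open>simp add: hitting_discount_def\<close>)
  qed
qed

text \<open>The dominating function is the supremum over the sequence of levels. Being countable it
  is measurable, and the supremum over all times serves only to bound its integral.\<close>

lemma hitting_discount_dominator:
  assumes x: "x \<in> einterval a b" and Y: "\<And>n::nat. Y n \<in> einterval a b"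
    and fin: "(\<integral>\<^sup>+\<omega>. (SUP t\<in>{0..}. ennreal \<bar>exp (- r * t) * f (X t \<omega>)\<bar>) \<partial>P x) < \<infinity>"
  obtains w where "integrable (P x) w" "AE \<omega> in P x. \<forall>n. \<bar>f (Y n) * hitting_discount (Y n) \<omega>\<bar> \<le> w \<omega>"
proof -
  define S where "S \<omega> = (SUP n. ennreal \<bar>f (Y n) * hitting_discount (Y n) \<omega>\<bar>)" for \<omega>
  have space: "space (P x) = \<Omega>" using sets_eq_imp_space_eq[OF sets_P[OF x]] by (simp add: space_F)
  have [measurable]: "hitting_discount (Y n) \<in> borel_measurable (P x)" for n
    using integrable_hitting_discount[OF x Y] by (rule borel_measurable_integrable)
  have [measurable]: "S \<in> borel_measurable (P x)" unfolding S_def by measurable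
  have "(\<integral>\<^sup>+\<omega>. S \<omega> \<partial>P x) \<le> (\<integral>\<^sup>+\<omega>. (SUP t\<in>{0..}. ennreal \<bar>exp (- r * t) * f (X t \<omega>)\<bar>) \<partial>P x)"
    unfolding S_def by (intro nn_integral_mono SUP_least hitting_discount_le_sup) (simp add: space)
  then have S: "(\<integral>\<^sup>+\<omega>. S \<omega> \<partial>P x) < \<infinity>" using fin by (rule le_less_trans)
  then have AE: "AE \<omega> in P x. S \<omega> \<noteq> \<infinity>" by (intro nn_integral_PInf_AE) auto
  show ?thesis
  proof (rule that)
    have "(\<integral>\<^sup>+\<omega>. ennreal (norm (enn2real (S \<omega>))) \<partial>P x) = (\<integral>\<^sup>+\<omega>. S \<omega> \<partial>P x)"
      by (rule nn_integral_cong_AE) (use AE in eventually_elim, auto simp: less_top)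
    then show "integrable (P x) (\<lambda>\<omega>. enn2real (S \<omega>))"
      using S by (intro integrableI_bounded) auto
    show "AE \<omega> in P x. \<forall>n. \<bar>f (Y n) * hitting_discount (Y n) \<omega>\<bar> \<le> enn2real (S \<omega>)"
      using AE
    proof eventually_elim
      case (elim \<omega>)
      show ?case
      proof
        fix n
        have "ennreal \<bar>f (Y n) * hitting_discount (Y n) \<omega>\<bar> \<le> S \<omega>"
          unfolding S_def by (rule SUP_upper) simp
        then have "enn2real (ennreal \<bar>f (Y n) * hitting_discount (Y n) \<omega>\<bar>) \<le> enn2real (S \<omega>)"
          using elim by (intro enn2real_mono) (auto simp: less_top)
        then show "\<bar>f (Y n) * hitting_discount (Y n) \<omega>\<bar> \<le> enn2real (S \<omega>)" by simp
      qed
    qed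
  qed
qed

text \<open>The common limit of the two discounted obstacles cancels in their difference, which
  therefore tends to 0 along the hitting times; the two dominators allow passing to
  expectations.\<close>

lemma gap_times_discount_tendsto_zero:
  assumes x: "x \<in> einterval a b" and Y: "\<And>n::nat. Y n \<in> einterval a b"
    and escape: "\<And>K. compact K \<Longrightarrow> K \<subseteq> einterval a b \<Longrightarrow> \<forall>\<^sub>F n in sequentially. Y n \<notin> K"
    and G: "(\<integral>\<^sup>+\<omega>. (SUP t\<in>{0..}. ennreal \<bar>exp (- r * t) * G (X t \<omega>)\<bar>) \<partial>P x) < \<infinity>"
    and H: "(\<integral>\<^sup>+\<omega>. (SUP t\<in>{0..}. ennreal \<bar>exp (- r * t) * H (X t \<omega>)\<bar>) \<partial>P x) < \<infinity>"
    and lim: "AE \<omega> in P x. \<exists>L::real. ((\<lambda>t. exp (- r * t) * G (X t \<omega>)) \<longlongrightarrow> L) at_top \<and>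
      ((\<lambda>t. exp (- r * t) * H (X t \<omega>)) \<longlongrightarrow> L) at_top"
  shows "(\<lambda>n. (H (Y n) - G (Y n)) * (\<integral>\<omega>. hitting_discount (Y n) \<omega> \<partial>P x)) \<longlonglongrightarrow> 0"
proof -
  obtain wG where wG: "integrable (P x) wG"
    "AE \<omega> in P x. \<forall>n. \<bar>G (Y n) * hitting_discount (Y n) \<omega>\<bar> \<le> wG \<omega>"
    by (rule hitting_discount_dominator[OF x Y G])
  obtain wH where wH: "integrable (P x) wH"
    "AE \<omega> in P x. \<forall>n. \<bar>H (Y n) * hitting_discount (Y n) \<omega>\<bar> \<le> wH \<omega>"
    by (rule hitting_discount_dominator[OF x Y H])
  have space: "space (P x) = \<Omega>" using sets_eq_imp_space_eq[OF sets_P[OF x]] by (simp add: space_F)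
  have [measurable]: "hitting_discount (Y n) \<in> borel_measurable (P x)" for n
    using integrable_hitting_discount[OF x Y] by (rule borel_measurable_integrable)
  have "(\<lambda>n. \<integral>\<omega>. (H (Y n) - G (Y n)) * hitting_discount (Y n) \<omega> \<partial>P x) \<longlonglongrightarrow> (\<integral>\<omega>. 0 \<partial>P x)"
  proof (rule integral_dominated_convergence[where w = "\<lambda>\<omega>. wH \<omega> + wG \<omega>"])
    show "integrable (P x) (\<lambda>\<omega>. wH \<omega> + wG \<omega>)" using wG wH by simp
    show "AE \<omega> in P x. (\<lambda>n. (H (Y n) - G (Y n)) * hitting_discount (Y n) \<omega>) \<longlonglongrightarrow> 0"
      using lim AE_space
    proof eventually_elim
      case (elim \<omega>)
      then obtain L where "((\<lambda>t. exp (- r * t) * G (X t \<omega>)) \<longlongrightarrow> L) at_top"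
        "((\<lambda>t. exp (- r * t) * H (X t \<omega>)) \<longlongrightarrow> L) at_top" by blast
      from tendsto_diff[OF this(2,1)]
      have "((\<lambda>t. exp (- r * t) * (H (X t \<omega>) - G (X t \<omega>))) \<longlongrightarrow> 0) at_top"
        by (simp add: right_diff_distrib)
      then show ?case
        using elim space by (intro hitting_discount_tendsto_zero[OF _ escape, where f = "\<lambda>y. H y - G y"]) auto
    qed
    show "AE \<omega> in P x. norm ((H (Y n) - G (Y n)) * hitting_discount (Y n) \<omega>) \<le> wH \<omega> + wG \<omega>" for n
      using wG(2) wH(2)
    proof eventually_elim
      case (elim \<omega>)
      have "norm ((H (Y n) - G (Y n)) * hitting_discount (Y n) \<omega>)
          \<le> \<bar>H (Y n) * hitting_discount (Y n) \<omega>\<bar> + \<bar>G (Y n) * hitting_discount (Y n) \<omega>\<bar>"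
        by (simp add: left_diff_distrib abs_triangle_ineq4)
      also have "\<dots> \<le> wH \<omega> + wG \<omega>" using elim by (intro add_mono) auto
      finally show ?case .
    qed
  qed auto
  then show ?thesis by simp
qed

section \<open>The gap between the obstacles near the endpoints\<close>

abbreviation "F \<equiv> scale_quotient \<phi> \<psi>"

lemma sequence_to_left:
  obtains Y :: "nat \<Rightarrow> real" where "\<And>n. Y n \<in> einterval a b"
    "filterlim (\<lambda>n. ereal (Y n)) (at_right a) sequentially"
proof -
  obtain Y :: "nat \<Rightarrow> real" where Y: "\<And>n. a < Y n" "\<And>n. Y n < b" "(\<lambda>n. ereal (Y n)) \<longlonglongrightarrow> a"
    using ereal_decseq_approx[OF endpoints] by metis
  then show ?thesis
    by (intro that[of Y]) (auto simp: einterval_iff filterlim_at intro!: always_eventually less_imp_neq[symmetric])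
qed

lemma sequence_to_right:
  obtains Y :: "nat \<Rightarrow> real" where "\<And>n. Y n \<in> einterval a b"
    "filterlim (\<lambda>n. ereal (Y n)) (at_left b) sequentially"
proof -
  obtain Y :: "nat \<Rightarrow> real" where Y: "\<And>n. a < Y n" "\<And>n. Y n < b" "(\<lambda>n. ereal (Y n)) \<longlonglongrightarrow> b"
    using ereal_incseq_approx[OF endpoints] by metis
  then show ?thesis
    by (intro that[of Y]) (auto simp: einterval_iff filterlim_at intro!: always_eventually less_imp_neq)
qed

lemma eventually_less_of_left:
  assumes "filterlim (\<lambda>n. ereal (Y n)) (at_right a) sequentially" "x \<in> einterval a b"
  shows "\<forall>\<^sub>F n in sequentially. Y n < x"
proof -
  have "(\<lambda>n. ereal (Y n)) \<longlonglongrightarrow> a" using assms by (simp add: filterlim_at)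
  from order_tendstoD(2)[OF this, of x] assms show ?thesis by (simp add: einterval_iff)
qed

lemma eventually_greater_of_right:
  assumes "filterlim (\<lambda>n. ereal (Y n)) (at_left b) sequentially" "x \<in> einterval a b"
  shows "\<forall>\<^sub>F n in sequentially. x < Y n"
proof -
  have "(\<lambda>n. ereal (Y n)) \<longlonglongrightarrow> b" using assms by (simp add: filterlim_at)
  from order_tendstoD(1)[OF this, of x] assms show ?thesis by (simp add: einterval_iff)
qed

lemma gap_left:
  assumes x: "x \<in> einterval a b" and "0 < e"
    and G: "(\<integral>\<^sup>+\<omega>. (SUP t\<in>{0..}. ennreal \<bar>exp (- r * t) * G (X t \<omega>)\<bar>) \<partial>P x) < \<infinity>"
    and H: "(\<integral>\<^sup>+\<omega>. (SUP t\<in>{0..}. ennreal \<bar>exp (- r * t) * H (X t \<omega>)\<bar>) \<partial>P x) < \<infinity>"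
    and lim: "AE \<omega> in P x. \<exists>L::real. ((\<lambda>t. exp (- r * t) * G (X t \<omega>)) \<longlongrightarrow> L) at_top \<and>
      ((\<lambda>t. exp (- r * t) * H (X t \<omega>)) \<longlongrightarrow> L) at_top"
  shows "\<exists>y\<in>einterval a b. y \<le> x \<and> H y - G y \<le> e * \<psi> y"
proof -
  obtain Y :: "nat \<Rightarrow> real" where Y: "\<And>n. Y n \<in> einterval a b"
    and Ya: "filterlim (\<lambda>n. ereal (Y n)) (at_right a) sequentially" using sequence_to_left by metis
  have escape: "\<forall>\<^sub>F n in sequentially. Y n \<notin> K" if K: "compact K" "K \<subseteq> einterval a b" for K
  proof (cases "K = {}")
    case False
    then obtain k where k: "k \<in> K" "\<And>t. t \<in> K \<Longrightarrow> k \<le> t" using compact_attains_inf K by metis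
    have "\<forall>\<^sub>F n in sequentially. Y n < k" using Ya k K by (intro eventually_less_of_left) auto
    then show ?thesis by eventually_elim (use k in force)
  qed simp
  \<comment> \<open>For levels below \<open>x\<close> the expected discount is
    \<open>\<psi> x / \<psi> (Y n)\<close>; with this threshold the factor \<open>\<psi> x\<close>
    cancels and the gap relative to \<open>\<psi> (Y n)\<close> is left.\<close>
  have "0 < e * \<psi> x" using \<open>0 < e\<close> \<psi>_pos x by simp
  moreover have "(\<lambda>n. (H (Y n) - G (Y n)) * (\<integral>\<omega>. hitting_discount (Y n) \<omega> \<partial>P x)) \<longlonglongrightarrow> 0"
    by (rule gap_times_discount_tendsto_zero[OF x Y _ G H lim]) (rule escape)
  ultimately have "\<forall>\<^sub>F n in sequentially.
      (H (Y n) - G (Y n)) * (\<integral>\<omega>. hitting_discount (Y n) \<omega> \<partial>P x) < e * \<psi> x"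
    by (intro order_tendstoD(2))
  with eventually_less_of_left[OF Ya x]
  have "\<forall>\<^sub>F n in sequentially. Y n < x \<and>
      (H (Y n) - G (Y n)) * (\<integral>\<omega>. hitting_discount (Y n) \<omega> \<partial>P x) < e * \<psi> x"
    by eventually_elim simp
  then obtain n where n: "Y n < x"
    "(H (Y n) - G (Y n)) * (\<integral>\<omega>. hitting_discount (Y n) \<omega> \<partial>P x) < e * \<psi> x"
    by (auto dest!: eventually_happens simp: eventually_sequentially)
  then have "(H (Y n) - G (Y n)) * (\<psi> x / \<psi> (Y n)) < e * \<psi> x"
    by (simp add: integral_hitting_discount[OF x Y])
  then have "(H (Y n) - G (Y n)) / \<psi> (Y n) * \<psi> x < e * \<psi> x" by simp
  then have "(H (Y n) - G (Y n)) / \<psi> (Y n) < e"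
    using \<psi>_pos[OF x] by (simp only: mult_less_cancel_right_pos)
  then have "H (Y n) - G (Y n) \<le> e * \<psi> (Y n)" using \<psi>_pos[OF Y, of n] by (simp add: divide_less_eq)
  then show ?thesis using n Y by (intro bexI[of _ "Y n"]) auto
qed

lemma gap_right:
  assumes x: "x \<in> einterval a b" and "0 < e"
    and G: "(\<integral>\<^sup>+\<omega>. (SUP t\<in>{0..}. ennreal \<bar>exp (- r * t) * G (X t \<omega>)\<bar>) \<partial>P x) < \<infinity>"
    and H: "(\<integral>\<^sup>+\<omega>. (SUP t\<in>{0..}. ennreal \<bar>exp (- r * t) * H (X t \<omega>)\<bar>) \<partial>P x) < \<infinity>"
    and lim: "AE \<omega> in P x. \<exists>L::real. ((\<lambda>t. exp (- r * t) * G (X t \<omega>)) \<longlongrightarrow> L) at_top \<and>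
      ((\<lambda>t. exp (- r * t) * H (X t \<omega>)) \<longlongrightarrow> L) at_top"
  shows "\<exists>y\<in>einterval a b. x \<le> y \<and> H y - G y \<le> e * \<phi> y"
proof -
  obtain Y :: "nat \<Rightarrow> real" where Y: "\<And>n. Y n \<in> einterval a b"
    and Yb: "filterlim (\<lambda>n. ereal (Y n)) (at_left b) sequentially" using sequence_to_right by metis
  have escape: "\<forall>\<^sub>F n in sequentially. Y n \<notin> K" if K: "compact K" "K \<subseteq> einterval a b" for K
  proof (cases "K = {}")
    case False
    then obtain k where k: "k \<in> K" "\<And>t. t \<in> K \<Longrightarrow> t \<le> k" using compact_attains_sup K by metis
    have "\<forall>\<^sub>F n in sequentially. k < Y n" using Yb k K by (intro eventually_greater_of_right) auto
    then show ?thesis by eventually_elim (use k in force)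
  qed simp
  have "0 < e * \<phi> x" using \<open>0 < e\<close> \<phi>_pos x by simp
  moreover have "(\<lambda>n. (H (Y n) - G (Y n)) * (\<integral>\<omega>. hitting_discount (Y n) \<omega> \<partial>P x)) \<longlonglongrightarrow> 0"
    by (rule gap_times_discount_tendsto_zero[OF x Y _ G H lim]) (rule escape)
  ultimately have "\<forall>\<^sub>F n in sequentially.
      (H (Y n) - G (Y n)) * (\<integral>\<omega>. hitting_discount (Y n) \<omega> \<partial>P x) < e * \<phi> x"
    by (intro order_tendstoD(2))
  with eventually_greater_of_right[OF Yb x]
  have "\<forall>\<^sub>F n in sequentially. x < Y n \<and>
      (H (Y n) - G (Y n)) * (\<integral>\<omega>. hitting_discount (Y n) \<omega> \<partial>P x) < e * \<phi> x"
    by eventually_elim simp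
  then obtain n where n: "x < Y n"
    "(H (Y n) - G (Y n)) * (\<integral>\<omega>. hitting_discount (Y n) \<omega> \<partial>P x) < e * \<phi> x"
    by (auto dest!: eventually_happens simp: eventually_sequentially)
  then have "(H (Y n) - G (Y n)) * (\<phi> x / \<phi> (Y n)) < e * \<phi> x"
    by (simp add: integral_hitting_discount[OF x Y])
  then have "(H (Y n) - G (Y n)) / \<phi> (Y n) * \<phi> x < e * \<phi> x" by simp
  then have "(H (Y n) - G (Y n)) / \<phi> (Y n) < e"
    using \<phi>_pos[OF x] by (simp only: mult_less_cancel_right_pos)
  then have "H (Y n) - G (Y n) \<le> e * \<phi> (Y n)" using \<phi>_pos[OF Y, of n] by (simp add: divide_less_eq)
  then show ?thesis using n Y by (intro bexI[of _ "Y n"]) auto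
qed

section \<open>The scale \<open>F\<close> and the transformed obstacles\<close>

lemma F_pos: "x \<in> einterval a b \<Longrightarrow> 0 < F x"
  using \<phi>_pos \<psi>_pos by (simp add: scale_quotient_def)

lemma F_continuous: "continuous_on (einterval a b) F"
  unfolding scale_quotient_def[abs_def]
  using \<psi>_pos by (intro continuous_intros \<phi>_continuous \<psi>_continuous) force

lemma F_less_iff:
  assumes "x \<in> einterval a b" "y \<in> einterval a b"
  shows "F x < F y \<longleftrightarrow> x < y"
proof -
  have less: "F x < F y" if "x \<in> einterval a b" "y \<in> einterval a b" "x < y" for x y
  proof -
    have "\<phi> x < \<phi> y" using strict_mono_onD[OF \<phi>_increasing] that by auto
    moreover have "\<psi> y < \<psi> x" using monotone_onD[OF \<psi>_decreasing] that by auto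
    ultimately show ?thesis
      unfolding scale_quotient_def using that \<phi>_pos \<psi>_pos by (intro frac_less) (auto intro: less_imp_le)
  qed
  show ?thesis using less[OF assms] less[OF assms(2,1)] by (cases x y rule: linorder_cases) auto
qed

lemma F_le_iff:
  assumes "x \<in> einterval a b" "y \<in> einterval a b"
  shows "F x \<le> F y \<longleftrightarrow> x \<le> y"
  using F_less_iff[OF assms(2,1)] by (simp add: not_less[symmetric])

lemma F_bij: "bij_betw F (einterval a b) {0<..}"
  unfolding bij_betw_def
proof
  show "inj_on F (einterval a b)"
    by (intro inj_onI antisym) (simp_all add: F_le_iff[symmetric])
  show "F ` einterval a b = {0<..}"
  proof (intro equalityI subsetI)
    fix w :: real assume "w \<in> {0<..}"
    then have w: "0 < w" by simp
    \<comment> \<open>A reference point that freezes one factor of \<open>F\<close>: to its left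
      \<open>F\<close> is less than \<open>\<phi> / \<psi> c\<close>, which tends to 0 at
      \<open>a\<close>; to its right it exceeds \<open>\<phi> c / \<psi>\<close>, which tends to
      infinity at \<open>b\<close>.\<close>
    obtain c where c: "c \<in> einterval a b" using sequence_to_left by metis
    have pos: "0 < \<phi> c" "0 < \<psi> c" using c \<phi>_pos \<psi>_pos by auto
    obtain x where x: "x \<in> einterval a b" "F x < w"
    proof -
      obtain Y :: "nat \<Rightarrow> real" where Y: "\<And>n. Y n \<in> einterval a b"
        and Ya: "filterlim (\<lambda>n. ereal (Y n)) (at_right a) sequentially" using sequence_to_left by metis
      have "(\<lambda>n. \<phi> (Y n)) \<longlonglongrightarrow> 0" using filterlim_compose[OF \<phi>_left Ya] by simp
      moreover have "0 < w * \<psi> c" using w pos by simp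
      ultimately have "\<forall>\<^sub>F n in sequentially. \<phi> (Y n) < w * \<psi> c" by (rule order_tendstoD)
      then have "\<forall>\<^sub>F n in sequentially. F (Y n) < w"
        using eventually_less_of_left[OF Ya c]
      proof eventually_elim
        case (elim n)
        then have "\<psi> c < \<psi> (Y n)" using monotone_onD[OF \<psi>_decreasing] Y c by auto
        then have "w * \<psi> c < w * \<psi> (Y n)" using w by simp
        then show ?case using elim \<psi>_pos[OF Y, of n] by (simp add: scale_quotient_def divide_less_eq)
      qed
      then show ?thesis using that Y by (auto dest!: eventually_happens)
    qed
    obtain z where z: "z \<in> einterval a b" "w < F z"
    proof -
      obtain Y :: "nat \<Rightarrow> real" where Y: "\<And>n. Y n \<in> einterval a b"
        and Yb: "filterlim (\<lambda>n. ereal (Y n)) (at_left b) sequentially" using sequence_to_right by metis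
      have "(\<lambda>n. \<psi> (Y n)) \<longlonglongrightarrow> 0" using filterlim_compose[OF \<psi>_right Yb] by simp
      moreover have "0 < \<phi> c / w" using w pos by simp
      ultimately have "\<forall>\<^sub>F n in sequentially. \<psi> (Y n) < \<phi> c / w" by (rule order_tendstoD)
      then have "\<forall>\<^sub>F n in sequentially. w < F (Y n)"
        using eventually_greater_of_right[OF Yb c]
      proof eventually_elim
        case (elim n)
        then have "\<phi> c < \<phi> (Y n)" using strict_mono_onD[OF \<phi>_increasing] Y c by auto
        moreover have "w * \<psi> (Y n) < \<phi> c" using elim w by (simp add: field_simps)
        ultimately show ?case using \<psi>_pos[OF Y, of n] by (simp add: scale_quotient_def less_divide_eq)
      qed
      then show ?thesis using that Y by (auto dest!: eventually_happens)
    qed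
    have "connected (F ` einterval a b)"
      by (intro connected_continuous_image F_continuous is_interval_connected is_interval_einterval)
    from connectedD_interval[OF this, of "F x" "F z" w] x z show "w \<in> F ` einterval a b" by auto
  qed (use F_pos in auto)
qed

lemma transformed_F:
  assumes "x \<in> einterval a b"
  shows "transformed (einterval a b) \<phi> \<psi> f (F x) = f x / \<psi> x"
  using inv_into_f_f[OF bij_betw_imp_inj_on[OF F_bij] assms] by (simp add: transformed_def Let_def)

lemma transformed_continuous:
  assumes "continuous_on (einterval a b) f"
  shows "continuous_on {0<..} (transformed (einterval a b) \<phi> \<psi> f)"
proof -
  define Finv where "Finv = inv_into (einterval a b) F"
  have Finv: "Finv w \<in> einterval a b" "F (Finv w) = w" if "0 < w" for w
    using that bij_betw_inv_into_right[OF F_bij] bij_betw_apply[OF bij_betw_inv_into[OF F_bij]]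
    by (auto simp: Finv_def)
  have "Finv ` {0<..} = einterval a b"
    using bij_betw_inv_into[OF F_bij] by (simp add: Finv_def bij_betw_def)
  \<comment> \<open>A monotone function with open image has no jumps.\<close>
  then have "continuous_on {0<..} Finv"
    using Finv by (intro continuous_onI_mono) (auto simp: F_le_iff[symmetric])
  moreover have "continuous_on (einterval a b) (\<lambda>x. f x / \<psi> x)"
    using \<psi>_pos by (intro continuous_intros assms \<psi>_continuous) force
  ultimately have "continuous_on {0<..} (\<lambda>w. f (Finv w) / \<psi> (Finv w))"
    using Finv by (intro continuous_on_compose2[of "einterval a b" "\<lambda>x. f x / \<psi> x" _ Finv]) auto
  then show ?thesis by (simp add: transformed_def[abs_def] Let_def Finv_def)
qed

lemma taut_string_transformed:
  assumes G: "continuous_on (einterval a b) G" and H: "continuous_on (einterval a b) H"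
    and GH: "\<And>x. x \<in> einterval a b \<Longrightarrow> G x \<le> H x"
    and finG: "\<And>x. x \<in> einterval a b \<Longrightarrow>
      (\<integral>\<^sup>+\<omega>. (SUP t\<in>{0..}. ennreal \<bar>exp (- r * t) * G (X t \<omega>)\<bar>) \<partial>P x) < \<infinity>"
    and finH: "\<And>x. x \<in> einterval a b \<Longrightarrow>
      (\<integral>\<^sup>+\<omega>. (SUP t\<in>{0..}. ennreal \<bar>exp (- r * t) * H (X t \<omega>)\<bar>) \<partial>P x) < \<infinity>"
    and lim: "\<And>x. x \<in> einterval a b \<Longrightarrow> AE \<omega> in P x. \<exists>L::real.
      ((\<lambda>t. exp (- r * t) * G (X t \<omega>)) \<longlongrightarrow> L) at_top \<and>
      ((\<lambda>t. exp (- r * t) * H (X t \<omega>)) \<longlongrightarrow> L) at_top"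
  obtains u where
    "taut_string (transformed (einterval a b) \<phi> \<psi> G) (transformed (einterval a b) \<phi> \<psi> H) u"
proof -
  define V where "V = transformed (einterval a b) \<phi> \<psi> G"
  define W where "W = transformed (einterval a b) \<phi> \<psi> H"
  have F_onto: "\<exists>x\<in>einterval a b. w = F x" if "0 < w" for w
    using F_bij that by (auto simp: bij_betw_def)
  have VW_F: "V (F x) = G x / \<psi> x" "W (F x) = H x / \<psi> x" if "x \<in> einterval a b" for x
    using that by (simp_all add: V_def W_def transformed_F)
  have gap_F: "W (F x) - V (F x) = (H x - G x) / \<psi> x" if "x \<in> einterval a b" for x
    using that by (simp add: VW_F diff_divide_distrib)
  have cont: "continuous_on {0<..} V" "continuous_on {0<..} W"
    using transformed_continuous[OF G] transformed_continuous[OF H] by (simp_all add: V_def W_def)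
  have VW: "V w \<le> W w" if "w \<in> {0<..}" for w
  proof -
    obtain x where x: "x \<in> einterval a b" "w = F x" using F_onto \<open>w \<in> {0<..}\<close> by auto
    then show ?thesis using GH \<psi>_pos by (simp add: VW_F divide_right_mono less_imp_le)
  qed
  obtain u where u: "\<And>x. x \<in> {0<..} \<Longrightarrow> V x \<le> u x" "\<And>x. x \<in> {0<..} \<Longrightarrow> u x \<le> W x"
    "continuous_on {0<..} u" "line_dominated {0<..} V u"
    "line_dominated {0<..} (\<lambda>x. - W x) (\<lambda>x. - u x)"
    using taut_string_exists[OF open_greaterThan cont VW] by metis
  have "taut_string V W u"
  proof
    fix w e :: real assume "0 < w" "0 < e"
    then obtain x where x: "x \<in> einterval a b" "w = F x" using F_onto by blast
    obtain y where y: "y \<in> einterval a b" "y \<le> x" "H y - G y \<le> e * \<psi> y"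
      using gap_left[OF x(1) \<open>0 < e\<close> finG finH lim] x(1) by blast
    then have "W (F y) - V (F y) \<le> e" using \<psi>_pos[of y] by (simp add: gap_F divide_le_eq)
    then show "\<exists>y. 0 < y \<and> y \<le> w \<and> W y - V y \<le> e"
      using x y F_pos[of y] by (intro exI[of _ "F y"]) (simp add: F_le_iff)
    obtain z where z: "z \<in> einterval a b" "x \<le> z" "H z - G z \<le> e * \<phi> z"
      using gap_right[OF x(1) \<open>0 < e\<close> finG finH lim] x(1) by blast
    \<comment> \<open>Division by \<open>\<psi>\<close> turns the bound by \<open>\<phi>\<close>
      near \<open>b\<close> into one by \<open>F\<close>, which is the linear bound of
      \<open>gap_infinity\<close>; near \<open>a\<close> the bound by \<open>\<psi>\<close> became a
      constant.\<close>
    then have "(H z - G z) / \<psi> z \<le> e * \<phi> z / \<psi> z"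
      using \<psi>_pos[of z] by (intro divide_right_mono) auto
    then have "W (F z) - V (F z) \<le> e * F z"
      unfolding gap_F[OF z(1)] by (simp add: scale_quotient_def)
    then show "\<exists>z\<ge>w. W z - V z \<le> e * z"
      using x z by (intro exI[of _ "F z"]) (simp add: F_le_iff)
  qed (use cont u in auto)
  then show ?thesis using that unfolding V_def W_def by blast
qed

section \<open>Admissibility on the state space\<close>

lemma taut_string_admissible:
  assumes taut: "taut_string (transformed (einterval a b) \<phi> \<psi> G) (transformed (einterval a b) \<phi> \<psi> H) u"
    and Q: "\<And>x. x \<in> einterval a b \<Longrightarrow> Q x = u (F x) * \<psi> x"
  shows "Q \<in> Sup_admissible (einterval a b) \<phi> \<psi> G H \<inter> Sub_admissible (einterval a b) \<phi> \<psi> G H"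
proof -
  define V where "V = transformed (einterval a b) \<phi> \<psi> G"
  define W where "W = transformed (einterval a b) \<phi> \<psi> H"
  interpret taut_string V W u using taut by (simp add: V_def W_def)
  have Q_div: "Q x / \<psi> x = u (F x)" and VF: "V (F x) = G x / \<psi> x" and WF: "W (F x) = H x / \<psi> x"
    if "x \<in> einterval a b" for x
    using that \<psi>_pos[OF that] by (simp_all add: Q V_def W_def transformed_F)
  have bounds: "G x \<le> Q x" "Q x \<le> H x" if x: "x \<in> einterval a b" for x
    using V_le_u[OF F_pos[OF x]] u_le_W[OF F_pos[OF x]] \<psi>_pos[OF x]
    by (simp_all add: VF[OF x] WF[OF x] Q[OF x] pos_divide_le_eq pos_le_divide_eq)
  have "continuous_on (einterval a b) (\<lambda>x. u (F x) * \<psi> x)"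
    by (intro continuous_intros \<psi>_continuous continuous_on_compose2[OF u_continuous F_continuous])
      (use F_pos in auto)
  then have cont: "continuous_on (einterval a b) Q" by (simp add: Q cong: continuous_on_cong)
  \<comment> \<open>Every point of the scale interval comes from \<open>{y..z}\<close>, so a strict
    inequality between \<open>Q\<close> and an obstacle on \<open>{y..z}\<close> holds for
    \<open>u\<close> on all of \<open>{F y..F z}\<close>.\<close>
  have F_Icc: "\<exists>s\<in>{y..z}. t = F s"
    if "y < z" "{y..z} \<subseteq> einterval a b" "t \<in> {F y..F z}" for y z t
  proof -
    have yz: "y \<in> einterval a b" "z \<in> einterval a b" using that by auto
    then have "0 < t" using F_pos[of y] that by auto
    then obtain s where s: "s \<in> einterval a b" "t = F s" using F_bij by (auto simp: bij_betw_def)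
    then show ?thesis using that yz by (auto simp: F_le_iff)
  qed
  have segment: "F y < F z" "F y \<le> F x" "F x \<le> F z" "{F y..F z} \<subseteq> {0<..}"
    if "y \<le> x" "x \<le> z" "y < z" "{y..z} \<subseteq> einterval a b" for x y z
  proof -
    have "x \<in> einterval a b" "y \<in> einterval a b" "z \<in> einterval a b" using that by auto
    then show "F y < F z" "F y \<le> F x" "F x \<le> F z" "{F y..F z} \<subseteq> {0<..}"
      using that F_pos[of y] by (auto simp: F_less_iff F_le_iff)
  qed
  have "superharmonic_on \<phi> \<psi> {x \<in> einterval a b. Q x < H x} Q"
    unfolding superharmonic_on_def Let_def
  proof (intro allI impI)
    fix x y z assume *: "y \<le> x \<and> x \<le> z \<and> y < z \<and> {y..z} \<subseteq> {x \<in> einterval a b. Q x < H x}"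
    then have sub: "{y..z} \<subseteq> einterval a b" by auto
    have xyz: "x \<in> einterval a b" "y \<in> einterval a b" "z \<in> einterval a b" using sub * by auto
    note seg = segment[of y x z]
    \<comment> \<open>Concavity of \<open>u\<close> off \<open>W\<close> is convexity of
      \<open>- u\<close> off the obstacle \<open>- W\<close>.\<close>
    have "- u (F x) \<le> - u (F y) * ((F z - F x) / (F z - F y)) + - u (F z) * ((F x - F y) / (F z - F y))"
    proof (rule line_dominated_convex[OF dominated_W])
      show "- W t < - u t" if t: "t \<in> {F y..F z}" for t
      proof -
        obtain s where s: "s \<in> {y..z}" "t = F s" using F_Icc sub * t by blast
        then have "s \<in> einterval a b" "Q s < H s" using * by auto
        then have "Q s / \<psi> s < H s / \<psi> s" using \<psi>_pos by (simp add: divide_strict_right_mono)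
        then show ?thesis using s \<open>s \<in> einterval a b\<close> by (simp add: Q_div WF)
      qed
    qed (use seg sub * W_continuous u_continuous in
        \<open>auto intro!: continuous_intros intro: continuous_on_subset\<close>)
    then show "Q y / \<psi> y * ((F z - F x) / (F z - F y)) + Q z / \<psi> z * ((F x - F y) / (F z - F y))
        \<le> Q x / \<psi> x"
      by (simp add: Q_div xyz)
  qed
  moreover have "subharmonic_on \<phi> \<psi> {x \<in> einterval a b. G x < Q x} Q"
    unfolding subharmonic_on_def Let_def
  proof (intro allI impI)
    fix x y z assume *: "y \<le> x \<and> x \<le> z \<and> y < z \<and> {y..z} \<subseteq> {x \<in> einterval a b. G x < Q x}"
    then have sub: "{y..z} \<subseteq> einterval a b" by auto
    have xyz: "x \<in> einterval a b" "y \<in> einterval a b" "z \<in> einterval a b" using sub * by auto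
    note seg = segment[of y x z]
    have "u (F x) \<le> u (F y) * ((F z - F x) / (F z - F y)) + u (F z) * ((F x - F y) / (F z - F y))"
    proof (rule line_dominated_convex[OF dominated_V])
      show "V t < u t" if t: "t \<in> {F y..F z}" for t
      proof -
        obtain s where s: "s \<in> {y..z}" "t = F s" using F_Icc sub * t by blast
        then have "s \<in> einterval a b" "G s < Q s" using * by auto
        then have "G s / \<psi> s < Q s / \<psi> s" using \<psi>_pos by (simp add: divide_strict_right_mono)
        then show ?thesis using s \<open>s \<in> einterval a b\<close> by (simp add: Q_div VF)
      qed
    qed (use seg sub * V_continuous u_continuous in \<open>auto intro: continuous_on_subset\<close>)
    then show "Q x / \<psi> x
        \<le> Q y / \<psi> y * ((F z - F x) / (F z - F y)) + Q z / \<psi> z * ((F x - F y) / (F z - F y))"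
      by (simp add: Q_div xyz)
  qed
  ultimately show ?thesis
    using bounds cont by (auto simp: Sup_admissible_def Sub_admissible_def)
qed

end

theorem lemma20:
  fixes \<Omega> :: "'w set" and \<F> :: "ennreal \<Rightarrow> 'w measure" and a b :: ereal
    and P :: "real \<Rightarrow> 'w measure" and X :: "real \<Rightarrow> 'w \<Rightarrow> real"
    and r :: real and \<phi> \<psi> G H :: "real \<Rightarrow> real" and I :: "real set"
  assumes "discounted_diffusion \<Omega> \<F> a b P X r \<phi> \<psi>"
    and "I = einterval a b"
    and "continuous_on I G" and "continuous_on I H"
    and "\<And>x. x \<in> I \<Longrightarrow> G x \<le> H x"
    and "\<And>x. x \<in> I \<Longrightarrow>
      (\<integral>\<^sup>+\<omega>. (SUP t\<in>{0..}. ennreal \<bar>exp (- r * t) * G (X t \<omega>)\<bar>) \<partial>P x) < \<infinity>"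
    and "\<And>x. x \<in> I \<Longrightarrow>
      (\<integral>\<^sup>+\<omega>. (SUP t\<in>{0..}. ennreal \<bar>exp (- r * t) * H (X t \<omega>)\<bar>) \<partial>P x) < \<infinity>"
    and "\<And>x. x \<in> I \<Longrightarrow> AE \<omega> in P x. \<exists>L::real.
      ((\<lambda>t. exp (- r * t) * G (X t \<omega>)) \<longlongrightarrow> L) at_top \<and>
      ((\<lambda>t. exp (- r * t) * H (X t \<omega>)) \<longlongrightarrow> L) at_top"
  shows "(\<forall>x\<in>I. \<bar>lower_value I \<phi> \<psi> G H x\<bar> \<noteq> \<infinity>) \<and>
    (\<lambda>x. real_of_ereal (lower_value I \<phi> \<psi> G H x)) \<in> Sup_admissible I \<phi> \<psi> G H \<inter> Sub_admissible I \<phi> \<psi> G H \<and>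
    (\<forall>x\<in>I. \<bar>upper_value I \<phi> \<psi> G H x\<bar> \<noteq> \<infinity>) \<and>
    (\<lambda>x. real_of_ereal (upper_value I \<phi> \<psi> G H x)) \<in> Sup_admissible I \<phi> \<psi> G H \<inter> Sub_admissible I \<phi> \<psi> G H"
proof -
  interpret discounted_diffusion \<Omega> \<F> a b P X r \<phi> \<psi> by fact
  note I = \<open>I = einterval a b\<close>
  obtain u where u: "taut_string (transformed I \<phi> \<psi> G) (transformed I \<phi> \<psi> H) u"
    using taut_string_transformed[OF assms(3-8)[unfolded I]] unfolding I by metis
  \<comment> \<open>Both values are the same real number, determined by one taut string; this gives
    finiteness and settles both memberships at once.\<close>
  have eq: "lower_value I \<phi> \<psi> G H x = ereal (u (F x) * \<psi> x)"
    "upper_value I \<phi> \<psi> G H x = ereal (u (F x) * \<psi> x)" if "x \<in> I" for x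
    using taut_string.lower_biconjugate_eq[OF u F_pos] taut_string.upper_biconjugate_eq[OF u F_pos] that
    by (simp_all add: I lower_value_def upper_value_def)
  show ?thesis
    using taut_string_admissible[OF u[unfolded I]] eq by (simp add: I)
qed

end
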